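(* Let $d,t\geq1$. There is a constant $c=c(d,t)$ such that the following holds. Let $s\ge 3$ be an integer, let $P$ be a set of $N>16$ points in $\mathbb{R}^d$ and let $E\subset\binom{P}{3}$ be a symmetric ternary semi-algebraic relation on $P$ of complexity at most $t$. If $(P,E)$ is $K^{(3)}_s$-free, then there exists a subset $P'\subset P$ such that $\binom{P'}{3}\cap E=\emptyset$ and $$|P'|\geq 2^{\frac{(\log\log N)^2}{c^s\log\log\log N}}.$$
   Context: Logarithms are base 2. A ternary semi-algebraic relation $E\subset\binom{P}{3}$ of complexity at most $t$ on $P\subset\mathbb{R}^d$ is one for which there are $t$ polynomials $f_1,\dots,f_t\in\mathbb{R}[x_1,\dots,x_{3d}]$ of degree at most $t$ and a Boolean function $\Phi$ with $(p_1,p_2,p_3)\in E$ iff $\Phi(f_1(p_1,p_2,p_3)\ge0,\dots,f_t(p_1,p_2,p_3)\ge0)=1$; it is symmetric if this condition is invariant under permuting the three points. $(P,E)$ is $K^{(3)}_s$-free if every collection of $s$ points of $P$ contains a triple not in $E$. *)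

theory Defs
  imports "HOL-Analysis.Analysis" "HOL-Library.Poly_Mapping" "HOL-Library.Ramsey"
begin

(* Real polynomials in variables indexed by 'v: finitely supported maps from
   exponent vectors to coefficients. *)
type_synonym 'v real_mpoly = "('v \<Rightarrow>\<^sub>0 nat) \<Rightarrow>\<^sub>0 real"

definition total_degree :: "'v real_mpoly \<Rightarrow> nat" where
  "total_degree f =
     Max (insert 0 ((\<lambda>m. \<Sum>i\<in>Poly_Mapping.keys m. Poly_Mapping.lookup m i) ` Poly_Mapping.keys f))"

definition eval_mpoly :: "'v real_mpoly \<Rightarrow> ('v \<Rightarrow> real) \<Rightarrow> real" where
  "eval_mpoly f x =
     (\<Sum>m\<in>Poly_Mapping.keys f. Poly_Mapping.lookup f m *
        (\<Prod>i\<in>Poly_Mapping.keys m. x i ^ Poly_Mapping.lookup m i))"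

(* The index type 'd + 'd + 'd has 3d elements when d = CARD('d): one block of d
   coordinates for each of the three points. *)
definition triple_coords ::
  "real ^ 'd \<Rightarrow> real ^ 'd \<Rightarrow> real ^ 'd \<Rightarrow> 'd + 'd + 'd \<Rightarrow> real" where
  "triple_coords p q r = case_sum (($) p) (case_sum (($) q) (($) r))"

(* A triple in E is an unordered 3-subset of P.  Requiring the sign condition to decide
   membership for every ordering (p, q, r) of the triple expresses both that E is
   semi-algebraic and that it is symmetric. *)
definition symmetric_semialgebraic3 ::
  "nat \<Rightarrow> (real ^ 'd) set \<Rightarrow> (real ^ 'd) set set \<Rightarrow> bool" where
  "symmetric_semialgebraic3 t P E \<longleftrightarrow>
     E \<subseteq> nsets P 3 \<and>
     (\<exists>(fs :: ('d + 'd + 'd) real_mpoly list) (\<Phi> :: bool list \<Rightarrow> bool).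
        length fs = t \<and>
        (\<forall>f \<in> set fs. total_degree f \<le> t) \<and>
        (\<forall>p\<in>P. \<forall>q\<in>P. \<forall>r\<in>P. distinct [p, q, r] \<longrightarrow>
           ({p, q, r} \<in> E \<longleftrightarrow> \<Phi> (map (\<lambda>f. eval_mpoly f (triple_coords p q r) \<ge> 0) fs))))"

definition clique_free3 :: "nat \<Rightarrow> 'a set \<Rightarrow> 'a set set \<Rightarrow> bool" where
  "clique_free3 s P E \<longleftrightarrow> (\<forall>S \<in> nsets P s. \<exists>T \<in> nsets S 3. T \<notin> E)"

end

theory Submission
  imports Defs
begin

text \<open>Signs of polynomials are signs of linear forms in the monomials, and for linear forms an
  induction on the dimension shows that a finite point set has a subset of constant proportion on
  which at least half of any given forms have constant sign: if each form is normalised to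
  \<open>y - g\<^sub>h\<close>, the lower-dimensional differences \<open>g\<^sub>a - g\<^sub>h\<close> almost totally order the \<open>g\<^sub>h\<close> on a large
  subset, and one compares with a suitable pivot \<open>g\<^sub>a\<close>. Iterating, \<open>k\<close> forms become constant at the
  cost of a factor polynomial in \<open>k\<close>.

  Let \<open>M = log |P|\<close>. Either some link contains a clique of size \<open>2 ^ D\<close> with \<open>D\<close> a fixed power of
  \<open>M\<close>, which is \<open>K\<^bsub>s-1\<^esub>\<close>-free, and induction on \<open>s\<close> applies, or every set of size \<open>2 ^ M'\<close>, with \<open>M'\<close> not
  too small, contains a power of \<open>M\<close> many subsets of size \<open>2 ^ (M' / O(log M))\<close> such that all
  edges lie inside one of them; this step can be repeated about \<open>log M / log log M\<close> times. To
  find the subsets, one makes triples meeting several blocks depend on the blocks only, uses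
  Erdos--Rado to make the triples meeting three blocks non-edges, and passes in each block to a
  common cograph for the links of the representatives of the other blocks; in a cograph without
  cliques of size \<open>w\<close> one loses only a factor \<open>w\<close> by passing to an independent set.\<close>

section \<open>Sign patterns of linear forms\<close>

text \<open>Zero is grouped with the positive values, so this is constancy of the test
  \<open>0 \<le> f x\<close> that appears in semi-algebraic conditions.\<close>

definition const_sign :: "('b \<Rightarrow> real) \<Rightarrow> 'b set \<Rightarrow> bool" where
  "const_sign f B \<longleftrightarrow> (\<forall>x\<in>B. 0 \<le> f x) \<or> (\<forall>x\<in>B. f x < 0)"

text \<open>Losses are measured in bits: \<open>C\<close> bounds the logarithm of the shrinkage of
  \<open>B\<close>, uniformly in the number of functions.\<close>

definition halvable :: "nat \<Rightarrow> ('h \<Rightarrow> 'b \<Rightarrow> real) \<Rightarrow> bool" where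
  "halvable C f \<longleftrightarrow>
     (\<forall>H B. finite H \<longrightarrow> finite B \<longrightarrow>
        (\<exists>B'\<subseteq>B. card B \<le> 2 ^ C * card B' \<and> 2 * card {h\<in>H. \<not> const_sign (f h) B'} \<le> card H))"

lemma const_sign_subset: "const_sign f B \<Longrightarrow> B' \<subseteq> B \<Longrightarrow> const_sign f B'"
  unfolding const_sign_def by blast

lemma const_sign_scale:
  assumes "c > 0" and "\<And>x. f x = c * g x"
  shows "const_sign f B \<longleftrightarrow> const_sign g B"
  using assms by (simp add: const_sign_def zero_le_mult_iff mult_less_0_iff)

lemma halvableD:
  assumes "halvable C f" "finite H" "finite B"
  obtains B' where "B' \<subseteq> B" "card B \<le> 2 ^ C * card B'"
    "2 * card {h\<in>H. \<not> const_sign (f h) B'} \<le> card H"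
  using assms unfolding halvable_def by meson

text \<open>Constancy survives passing to subsets, so each round has to treat only the functions
  that are still not constant.\<close>

lemma halvable_iterate:
  assumes "halvable C f" "finite H" "finite B"
  shows "\<exists>B'\<subseteq>B. card B \<le> 2 ^ (C * b) * card B' \<and>
           2 ^ b * card {h\<in>H. \<not> const_sign (f h) B'} \<le> card H"
proof (induction b)
  case 0
  then show ?case using assms by (intro exI[of _ B]) (auto intro: card_mono)
next
  case (Suc b)
  then obtain B1 where B1: "B1 \<subseteq> B" "card B \<le> 2 ^ (C * b) * card B1"
    "2 ^ b * card {h\<in>H. \<not> const_sign (f h) B1} \<le> card H" by auto
  define H1 where "H1 = {h\<in>H. \<not> const_sign (f h) B1}"
  have "finite H1" "finite B1" using assms B1 finite_subset by (auto simp: H1_def)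
  then obtain B2 where B2: "B2 \<subseteq> B1" "card B1 \<le> 2 ^ C * card B2"
    "2 * card {h\<in>H1. \<not> const_sign (f h) B2} \<le> card H1"
    using halvableD[OF assms(1)] by metis
  have eq: "{h\<in>H. \<not> const_sign (f h) B2} = {h\<in>H1. \<not> const_sign (f h) B2}"
    using const_sign_subset B2(1) by (auto simp: H1_def)
  have "2 ^ Suc b * card {h\<in>H. \<not> const_sign (f h) B2} \<le> 2 ^ b * card H1"
    unfolding eq using B2(3) by simp
  also have "\<dots> \<le> card H" using B1(3) by (simp add: H1_def)
  finally have 1: "2 ^ Suc b * card {h\<in>H. \<not> const_sign (f h) B2} \<le> card H" .
  have "card B \<le> 2 ^ (C * b) * (2 ^ C * card B2)"
    using B1(2) B2(2) by (meson le_trans mult_le_mono2)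
  also have "\<dots> = 2 ^ (C * Suc b) * card B2" by (simp add: power_add)
  finally show ?case using 1 B1(1) B2(1) by (intro exI[of _ B2]) auto
qed

text \<open>A weaker form of \<open>halvable\<close> that asks for a fixed fraction of the functions
  only. The fraction 1/24 is what the induction on the dimension yields: a third for the sign of the
  last coefficient, an eighth for the comparison with a pivot.\<close>

definition homogenizable :: "nat \<Rightarrow> ('h \<Rightarrow> 'b \<Rightarrow> real) \<Rightarrow> bool" where
  "homogenizable C f \<longleftrightarrow>
     (\<forall>H B. finite H \<longrightarrow> finite B \<longrightarrow>
        (\<exists>B'\<subseteq>B. \<exists>H'\<subseteq>H. card B \<le> 2 ^ C * card B' \<and> card H \<le> 24 * card H' \<and>
           (\<forall>h\<in>H'. const_sign (f h) B')))"

lemma homogenizableD: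
  assumes "homogenizable C f" "finite H" "finite B"
  obtains B' H' where "B' \<subseteq> B" "H' \<subseteq> H" "card B \<le> 2 ^ C * card B'" "card H \<le> 24 * card H'"
    "\<forall>h\<in>H'. const_sign (f h) B'"
  using assms unfolding homogenizable_def by meson

text \<open>Each round makes at least 1/24 of the remaining functions constant, and 24 rounds
  suffice because (23/24)^24 < 1/2.\<close>

lemma halvable_if_homogenizable:
  fixes f :: "'h \<Rightarrow> 'b \<Rightarrow> real"
  assumes "homogenizable C f"
  shows "halvable (C * 24) f"
  unfolding halvable_def
proof (intro allI impI)
  fix H :: "'h set" and B :: "'b set" assume fin: "finite H" "finite B"
  have it: "\<exists>B'\<subseteq>B. card B \<le> 2 ^ (C * j) * card B' \<and>
           24 ^ j * card {h\<in>H. \<not> const_sign (f h) B'} \<le> 23 ^ j * card H" for j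
  proof (induction j)
    case 0
    then show ?case using fin by (intro exI[of _ B]) (auto intro: card_mono)
  next
    case (Suc j)
    then obtain B1 where B1: "B1 \<subseteq> B" "card B \<le> 2 ^ (C * j) * card B1"
      "24 ^ j * card {h\<in>H. \<not> const_sign (f h) B1} \<le> 23 ^ j * card H" by auto
    define H1 where "H1 = {h\<in>H. \<not> const_sign (f h) B1}"
    have fin1: "finite H1" "finite B1" using fin B1 finite_subset by (auto simp: H1_def)
    then obtain B2 H2 where B2: "B2 \<subseteq> B1" "H2 \<subseteq> H1" "card B1 \<le> 2 ^ C * card B2"
      "card H1 \<le> 24 * card H2" "\<forall>h\<in>H2. const_sign (f h) B2"
      using homogenizableD[OF assms] by metis
    have "{h\<in>H. \<not> const_sign (f h) B2} \<subseteq> H1 - H2"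
      using const_sign_subset B2 by (auto simp: H1_def)
    then have "card {h\<in>H. \<not> const_sign (f h) B2} \<le> card (H1 - H2)"
      using fin1 by (intro card_mono) auto
    also have "\<dots> = card H1 - card H2"
      using B2(2) fin1 by (meson card_Diff_subset finite_subset)
    finally have "24 * card {h\<in>H. \<not> const_sign (f h) B2} \<le> 23 * card H1"
      using B2(4) by linarith
    then have "24 ^ j * (24 * card {h\<in>H. \<not> const_sign (f h) B2}) \<le> 24 ^ j * (23 * card H1)"
      by (rule mult_le_mono2)
    also have "\<dots> = 23 * (24 ^ j * card H1)" by simp
    also have "\<dots> \<le> 23 * (23 ^ j * card H)" using B1(3) unfolding H1_def by (rule mult_le_mono2)
    finally have 1: "24 ^ Suc j * card {h\<in>H. \<not> const_sign (f h) B2} \<le> 23 ^ Suc j * card H"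
      by (simp add: mult.assoc mult.left_commute)
    have "card B \<le> 2 ^ (C * j) * (2 ^ C * card B2)"
      using B1(2) B2(3) by (meson le_trans mult_le_mono2)
    also have "\<dots> = 2 ^ (C * Suc j) * card B2" by (simp add: power_add)
    finally show ?case using 1 B1(1) B2(1) by (intro exI[of _ B2]) auto
  qed
  obtain B' where B': "B' \<subseteq> B" "card B \<le> 2 ^ (C * 24) * card B'"
    "24 ^ 24 * card {h\<in>H. \<not> const_sign (f h) B'} \<le> 23 ^ 24 * card H"
    using it[of 24] by auto
  have "2 * card {h\<in>H. \<not> const_sign (f h) B'} \<le> card H"
    using B'(3) by simp
  then show "\<exists>B'\<subseteq>B. card B \<le> 2 ^ (C * 24) * card B' \<and>
      2 * card {h\<in>H. \<not> const_sign (f h) B'} \<le> card H"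
    using B' by blast
qed

text \<open>Double counting: if every out-degree inside \<open>G\<close> were at most |H|/8, the
  comparable pairs would number at most |G||H|/4. Together with the at most |H|^2/16 incomparable
  ones they would cover at most 3/4 of \<open>G \<times> G\<close>.\<close>

lemma ex_large_out_degree:
  fixes H :: "'h set"
  assumes fin: "finite H" and GH: "G \<subseteq> H" "card H \<le> 2 * card G" and ne: "H \<noteq> {}"
    and bad: "16 * card {p\<in>H \<times> H. \<not> L (fst p) (snd p) \<and> \<not> L (snd p) (fst p)} \<le> (card H)\<^sup>2"
  shows "\<exists>a\<in>G. card H \<le> 8 * card {h\<in>G. L a h}"
proof (rule ccontr)
  assume "\<not> ?thesis"
  then have small: "8 * card {h\<in>G. L a h} \<le> card H" if "a \<in> G" for a using that by force
  have fG: "finite G" using fin GH finite_subset by blast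
  define X where "X = Sigma G (\<lambda>a. {h\<in>G. L a h})"
  define Y where "Y = {p\<in>H \<times> H. \<not> L (fst p) (snd p) \<and> \<not> L (snd p) (fst p)}"
  have "8 * card X = (\<Sum>a\<in>G. 8 * card {h\<in>G. L a h})"
    unfolding X_def using fG by (simp add: sum_distrib_left)
  also have "\<dots> \<le> card G * card H" using sum_bounded_above[OF small] by simp
  finally have X: "8 * card X \<le> card G * card H" .
  have fX: "finite X" "finite Y" using fG fin by (auto simp: X_def Y_def)
  have "G \<times> G \<subseteq> X \<union> prod.swap ` X \<union> Y" using GH by (force simp: X_def Y_def)
  then have "card (G \<times> G) \<le> card (X \<union> prod.swap ` X \<union> Y)"
    using fX by (intro card_mono) auto
  also have "\<dots> \<le> card X + card (prod.swap ` X) + card Y"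
    by (meson add_le_mono card_Un_le le_refl le_trans)
  also have "\<dots> \<le> 2 * card X + card Y" using card_image_le[OF fX(1), of prod.swap] by simp
  finally have "16 * (card G * card G) \<le> 4 * (card G * card H) + (card H)\<^sup>2"
    using X bad unfolding Y_def[symmetric] card_cartesian_product by linarith
  also have "\<dots> \<le> 4 * (card G * (2 * card G)) + (2 * card G)\<^sup>2"
    using GH(2) by (intro add_mono mult_le_mono power_mono) auto
  finally have "card G = 0" by (simp add: power2_eq_square)
  then show False using GH(2) ne fin by simp
qed

text \<open>Where the pivot \<open>g a\<close> lies below \<open>y\<close>, so does every
  \<open>g h\<close> with \<open>g h \<le> g a\<close>, and symmetrically from above. Thus a single
  pivot settles the signs for all \<open>h\<close> on the proper side of it.\<close>

lemma homogenize_graphs: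
  fixes g :: "'h \<Rightarrow> 'b \<Rightarrow> real" and y :: "'b \<Rightarrow> real"
  assumes hv: "halvable C (\<lambda>(a, h) b. g a b - g h b)" and fin: "finite H" "finite B"
  shows "\<exists>B'\<subseteq>B. \<exists>H'\<subseteq>H. card B \<le> 2 ^ (C * 4 + 1) * card B' \<and> card H \<le> 8 * card H' \<and>
           (\<forall>h\<in>H'. const_sign (\<lambda>b. y b - g h b) B')"
proof (cases "H = {}")
  case True
  then show ?thesis by (intro exI[of _ B]) auto
next
  case False
  let ?f = "\<lambda>(a, h) b. g a b - g h b"
  \<comment> \<open>Four rounds leave at most 1/16 of the ordered pairs without constant sign, the
    density that \<open>ex_large_out_degree\<close> tolerates.\<close>
  obtain B1 where B1: "B1 \<subseteq> B" "card B \<le> 2 ^ (C * 4) * card B1"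
     "2 ^ 4 * card {p\<in>H \<times> H. \<not> const_sign (?f p) B1} \<le> card (H \<times> H)"
    using halvable_iterate[OF hv, of "H \<times> H" B 4] fin by auto
  define L where "L a h \<longleftrightarrow> (\<forall>b\<in>B1. g h b \<le> g a b)" for a h
  have "{p\<in>H \<times> H. \<not> L (fst p) (snd p) \<and> \<not> L (snd p) (fst p)}
      \<subseteq> {p\<in>H \<times> H. \<not> const_sign (?f p) B1}"
    unfolding L_def const_sign_def by fastforce
  then have "card {p\<in>H \<times> H. \<not> L (fst p) (snd p) \<and> \<not> L (snd p) (fst p)}
      \<le> card {p\<in>H \<times> H. \<not> const_sign (?f p) B1}"
    using fin by (intro card_mono) auto
  then have bad: "16 * card {p\<in>H \<times> H. \<not> L (fst p) (snd p) \<and> \<not> L (snd p) (fst p)} \<le> (card H)\<^sup>2"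
    using B1(3) by (simp add: card_cartesian_product power2_eq_square)
  then have bad': "16 * card {p\<in>H \<times> H. \<not> L (snd p) (fst p) \<and> \<not> L (fst p) (snd p)} \<le> (card H)\<^sup>2"
    by (simp add: conj_commute)
  have fB1: "finite B1" using B1 fin finite_subset by blast
  \<comment> \<open>Possible pivots are split by the side of \<open>y\<close> on which their graph
    lies for at least half of \<open>B1\<close>. A pivot is taken from the larger class, and that
    half of \<open>B1\<close> is kept.\<close>
  define G where "G = {a\<in>H. card B1 \<le> 2 * card {b\<in>B1. g a b \<le> y b}}"
  have "card H = card G + card (H - G)"
    using fin card_Int_Diff[of H G] by (simp add: G_def Int_absorb1 Collect_conj_eq)
  then consider "card H \<le> 2 * card G" | "card H \<le> 2 * card (H - G)" by linarith
  then show ?thesis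
  proof cases
    case 1
    obtain a where a: "a \<in> G" "card H \<le> 8 * card {h\<in>G. L a h}"
      using ex_large_out_degree[OF fin(1) _ 1 False bad] by (auto simp: G_def)
    define B2 where "B2 = {b\<in>B1. g a b \<le> y b}"
    have B2: "card B1 \<le> 2 * card B2" using a by (simp add: G_def B2_def)
    have "card B \<le> 2 ^ (C * 4 + 1) * card B2"
      using order_trans[OF B1(2) mult_le_mono2[OF B2]] by simp
    moreover have "const_sign (\<lambda>b. y b - g h b) B2" if "h \<in> {h\<in>G. L a h}" for h
      using that by (force simp: const_sign_def B2_def L_def)
    ultimately show ?thesis using a(2) B1(1)
      by (intro exI[of _ B2] exI[of _ "{h\<in>G. L a h}"] conjI) (auto simp: B2_def G_def)
  next
    case 2
    \<comment> \<open>Now \<open>y < g a\<close> on at least half of \<open>B1\<close>, so the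
      graphs to collect lie above the pivot and the comparison is used in reverse.\<close>
    obtain a where a: "a \<in> H - G" "card H \<le> 8 * card {h\<in>H - G. L h a}"
      using ex_large_out_degree[OF fin(1) _ 2 False, of "\<lambda>a h. L h a"] bad' by auto
    define B2 where "B2 = {b\<in>B1. \<not> g a b \<le> y b}"
    have "card B1 = card {b\<in>B1. g a b \<le> y b} + card B2"
      unfolding B2_def using fB1
      by (subst card_Un_disjoint[symmetric]) (auto intro: arg_cong[where f=card])
    then have B2: "card B1 \<le> 2 * card B2" using a by (auto simp: G_def)
    have "card B \<le> 2 ^ (C * 4 + 1) * card B2"
      using order_trans[OF B1(2) mult_le_mono2[OF B2]] by simp
    moreover have "const_sign (\<lambda>b. y b - g h b) B2" if "h \<in> {h\<in>H - G. L h a}" for h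
      using that by (force simp: const_sign_def B2_def L_def)
    ultimately show ?thesis using a(2) B1(1)
      by (intro exI[of _ B2] exI[of _ "{h\<in>H - G. L h a}"] conjI) (auto simp: B2_def G_def)
  qed
qed

text \<open>The induction on the dimension compares pairs of forms, so its hypothesis is needed with
  pairs as indices. A finite \<open>H\<close> can be renamed by numbers.\<close>

lemma halvable_linear_any_index:
  fixes v :: "'b \<Rightarrow> nat \<Rightarrow> real" and u :: "'h \<Rightarrow> nat \<Rightarrow> real"
  assumes "\<And>u :: nat \<Rightarrow> nat \<Rightarrow> real. halvable C (\<lambda>h b. \<Sum>i<D. u h i * v b i)"
  shows "halvable C (\<lambda>h b. \<Sum>i<D. u h i * v b i)"
  unfolding halvable_def
proof (intro allI impI)
  fix H :: "'h set" and B :: "'b set" assume fin: "finite H" "finite B"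
  obtain e :: "'h \<Rightarrow> nat" where e: "inj_on e H"
    using finite_imp_inj_to_nat_seg[OF fin(1)] by blast
  define u' where "u' k = u (inv_into H e k)" for k
  have u': "u' (e h) = u h" if "h \<in> H" for h using e that by (simp add: u'_def)
  obtain B' where B': "B' \<subseteq> B" "card B \<le> 2 ^ C * card B'"
    "2 * card {k \<in> e ` H. \<not> const_sign (\<lambda>b. \<Sum>i<D. u' k i * v b i) B'} \<le> card (e ` H)"
    using halvableD[OF assms[of u'], of "e ` H" B] fin by blast
  have "{k \<in> e ` H. \<not> const_sign (\<lambda>b. \<Sum>i<D. u' k i * v b i) B'} =
     e ` {h \<in> H. \<not> const_sign (\<lambda>b. \<Sum>i<D. u h i * v b i) B'}"
    using u' by auto
  moreover have "inj_on e {h \<in> H. \<not> const_sign (\<lambda>b. \<Sum>i<D. u h i * v b i) B'}"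
    using e by (rule inj_on_subset) auto
  ultimately have "2 * card {h \<in> H. \<not> const_sign (\<lambda>b. \<Sum>i<D. u h i * v b i) B'} \<le> card H"
    using B'(3) e by (simp add: card_image)
  then show "\<exists>B'\<subseteq>B. card B \<le> 2 ^ C * card B' \<and>
      2 * card {h \<in> H. \<not> const_sign (\<lambda>b. \<Sum>i<D. u h i * v b i) B'} \<le> card H"
    using B' by blast
qed

text \<open>Induction on the number of coordinates. Dividing by the last coefficient gives the shape
  \<open>y - g h\<close> with a common \<open>y\<close>, and the differences of the
  \<open>g h\<close> have one coordinate less. The constant is chosen before \<open>u\<close> and
  \<open>v\<close>, so it depends neither on the forms nor on the points.\<close>

lemma linear_halvable_nat:
  "\<exists>C. \<forall>(u :: nat \<Rightarrow> nat \<Rightarrow> real) (v :: 'b \<Rightarrow> nat \<Rightarrow> real). halvable C (\<lambda>h b. \<Sum>i<D. u h i * v b i)"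
proof (induction D)
  case 0
  show ?case
    by (intro exI[of _ 0] allI) (auto simp: halvable_def const_sign_def)
next
  case (Suc D)
  then obtain C where C: "\<And>(u :: nat \<Rightarrow> nat \<Rightarrow> real) (v :: 'b \<Rightarrow> nat \<Rightarrow> real).
    halvable C (\<lambda>h b. \<Sum>i<D. u h i * v b i)" by blast
  have "homogenizable (C * 4 + 1) (\<lambda>h b. \<Sum>i<Suc D. u h i * v b i)"
    for u :: "nat \<Rightarrow> nat \<Rightarrow> real" and v :: "'b \<Rightarrow> nat \<Rightarrow> real"
    unfolding homogenizable_def
  proof (intro allI impI)
    fix H :: "nat set" and B :: "'b set" assume fin: "finite H" "finite B"
    have normalized: "\<exists>B'\<subseteq>B. \<exists>H'\<subseteq>H0. card B \<le> 2 ^ (C * 4 + 1) * card B' \<and> card H0 \<le> 8 * card H' \<and>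
           (\<forall>h\<in>H'. const_sign (\<lambda>b. y b - (\<Sum>i<D. w h i * v b i)) B')"
      if "finite H0" for H0 y and w :: "nat \<Rightarrow> nat \<Rightarrow> real"
    proof -
      have "(\<lambda>(a, h) b. (\<Sum>i<D. w a i * v b i) - (\<Sum>i<D. w h i * v b i)) =
          (\<lambda>p b. \<Sum>i<D. (w (fst p) i - w (snd p) i) * v b i)"
        by (auto simp: fun_eq_iff sum_subtractf algebra_simps)
      moreover have "halvable C (\<lambda>p b. \<Sum>i<D. (w (fst p) i - w (snd p) i) * v b i)"
        by (rule halvable_linear_any_index[OF C])
      ultimately show ?thesis
        using homogenize_graphs[of C "\<lambda>h b. \<Sum>i<D. w h i * v b i" H0 B y] that fin by simp
    qed
    define Hp where "Hp = {h\<in>H. u h D > 0}"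
    define Hn where "Hn = {h\<in>H. u h D < 0}"
    define Hz where "Hz = {h\<in>H. u h D = 0}"
    have finHp: "finite Hp" and finHn: "finite Hn" using fin by (auto simp: Hp_def Hn_def)
    have "H = Hp \<union> (Hn \<union> Hz)" by (auto simp: Hp_def Hn_def Hz_def)
    then have "card H = card (Hp \<union> (Hn \<union> Hz))" by (rule arg_cong)
    then have "card H \<le> card Hp + (card Hn + card Hz)"
      using card_Un_le[of Hp "Hn \<union> Hz"] card_Un_le[of Hn Hz] by linarith
    then consider "card H \<le> 3 * card Hp" | "card H \<le> 3 * card Hn" | "card H \<le> 3 * card Hz"
      by linarith
    then show "\<exists>B'\<subseteq>B. \<exists>H'\<subseteq>H. card B \<le> 2 ^ (C * 4 + 1) * card B' \<and> card H \<le> 24 * card H' \<and>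
           (\<forall>h\<in>H'. const_sign (\<lambda>b. \<Sum>i<Suc D. u h i * v b i) B')"
    proof cases
      case 1
      obtain B' H' where B': "B' \<subseteq> B" "H' \<subseteq> Hp" "card B \<le> 2 ^ (C * 4 + 1) * card B'"
        "card Hp \<le> 8 * card H'"
        "\<forall>h\<in>H'. const_sign (\<lambda>b. v b D - (\<Sum>i<D. (- u h i / u h D) * v b i)) B'"
        using normalized[OF finHp, of "\<lambda>b. v b D" "\<lambda>h i. - u h i / u h D"] by blast
      have "const_sign (\<lambda>b. \<Sum>i<Suc D. u h i * v b i) B'" if h: "h \<in> H'" for h
      proof -
        have pos: "u h D > 0" using h B' by (auto simp: Hp_def)
        have "(\<Sum>i<Suc D. u h i * v b i) = u h D * (v b D - (\<Sum>i<D. (- u h i / u h D) * v b i))" for b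
          using pos by (simp add: algebra_simps sum_distrib_left sum_negf)
        then have "const_sign (\<lambda>b. \<Sum>i<Suc D. u h i * v b i) B' \<longleftrightarrow>
            const_sign (\<lambda>b. v b D - (\<Sum>i<D. (- u h i / u h D) * v b i)) B'"
          by (rule const_sign_scale[OF pos])
        then show ?thesis using B'(5) h by blast
      qed
      then show ?thesis using B' 1
        by (intro exI[of _ B'] exI[of _ H'] conjI) (auto simp: Hp_def)
    next
      case 2
      \<comment> \<open>Dividing by the positive number \<open>- u h D\<close> respects the
        convention for zero; the common function becomes \<open>- v b D\<close>.\<close>
      obtain B' H' where B': "B' \<subseteq> B" "H' \<subseteq> Hn" "card B \<le> 2 ^ (C * 4 + 1) * card B'"
        "card Hn \<le> 8 * card H'"
        "\<forall>h\<in>H'. const_sign (\<lambda>b. - v b D - (\<Sum>i<D. (u h i / u h D) * v b i)) B'"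
        using normalized[OF finHn, of "\<lambda>b. - v b D" "\<lambda>h i. u h i / u h D"] by blast
      have "const_sign (\<lambda>b. \<Sum>i<Suc D. u h i * v b i) B'" if h: "h \<in> H'" for h
      proof -
        have neg: "u h D < 0" using h B' by (auto simp: Hn_def)
        have "(\<Sum>i<Suc D. u h i * v b i) = (- u h D) * (- v b D - (\<Sum>i<D. (u h i / u h D) * v b i))" for b
          using neg by (simp add: algebra_simps sum_distrib_left sum_negf)
        then have "const_sign (\<lambda>b. \<Sum>i<Suc D. u h i * v b i) B' \<longleftrightarrow>
            const_sign (\<lambda>b. - v b D - (\<Sum>i<D. (u h i / u h D) * v b i)) B'"
          using neg by (intro const_sign_scale[of "- u h D"]) auto
        then show ?thesis using B'(5) h by blast
      qed
      then show ?thesis using B' 2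
        by (intro exI[of _ B'] exI[of _ H'] conjI) (auto simp: Hn_def)
    next
      case 3
      have fz: "finite Hz" using fin by (simp add: Hz_def)
      \<comment> \<open>With vanishing last coefficient the forms have only \<open>D\<close>
        coordinates, and one halving gives more than the required fraction.\<close>
      obtain B' where B': "B' \<subseteq> B" "card B \<le> 2 ^ C * card B'"
        "2 * card {h\<in>Hz. \<not> const_sign (\<lambda>b. \<Sum>i<D. u h i * v b i) B'} \<le> card Hz"
        using halvableD[OF C fz fin(2)] by blast
      define H' where "H' = {h\<in>Hz. const_sign (\<lambda>b. \<Sum>i<D. u h i * v b i) B'}"
      have "card Hz = card H' + card {h\<in>Hz. \<not> const_sign (\<lambda>b. \<Sum>i<D. u h i * v b i) B'}"
        unfolding H'_def using fz
        by (subst card_Un_disjoint[symmetric]) (auto intro: arg_cong[where f=card])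
      then have "card H \<le> 24 * card H'" using B'(3) 3 by linarith
      moreover have "card B \<le> 2 ^ (C * 4 + 1) * card B'"
        using B'(2) by (rule order_trans) (intro mult_le_mono1 power_increasing, auto)
      ultimately show ?thesis using B'(1)
        by (intro exI[of _ B'] exI[of _ H'] conjI) (auto simp: Hz_def H'_def)
    qed
  qed
  then show ?case using halvable_if_homogenizable by blast
qed

lemma linear_halvable:
  obtains C where "\<And>(u :: 'h \<Rightarrow> nat \<Rightarrow> real) (v :: 'b \<Rightarrow> nat \<Rightarrow> real).
    halvable C (\<lambda>h b. \<Sum>i<D. u h i * v b i)"
proof -
  obtain C where "\<And>(u :: nat \<Rightarrow> nat \<Rightarrow> real) (v :: 'b \<Rightarrow> nat \<Rightarrow> real).
    halvable C (\<lambda>h b. \<Sum>i<D. u h i * v b i)" using linear_halvable_nat by blast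
  then have "halvable C (\<lambda>h b. \<Sum>i<D. u h i * v b i)"
    for u :: "'h \<Rightarrow> nat \<Rightarrow> real" and v :: "'b \<Rightarrow> nat \<Rightarrow> real"
    by (rule halvable_linear_any_index)
  then show thesis by (rule that)
qed

section \<open>Semi-algebraic relations\<close>

definition link_const :: "'a set set \<Rightarrow> 'a \<times> 'a \<Rightarrow> 'a set \<Rightarrow> bool" where
  "link_const E w B \<longleftrightarrow> (\<forall>z\<in>B. {fst w, snd w, z} \<in> E) \<or> (\<forall>z\<in>B. {fst w, snd w, z} \<notin> E)"

text \<open>This is everything that is used below about semi-algebraic relations. The pairs avoid
  \<open>B\<close> because the sign condition decides only triples of distinct points.\<close>

locale cutting =
  fixes P :: "'a set" and E :: "'a set set" and C :: nat
  assumes finite_P: "finite P"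
    and C_pos: "1 \<le> C"
    and cut: "\<And>W B b. W \<subseteq> P \<times> P \<Longrightarrow> B \<subseteq> P \<Longrightarrow>
      (\<And>x y. (x, y) \<in> W \<Longrightarrow> x \<noteq> y \<and> x \<notin> B \<and> y \<notin> B) \<Longrightarrow>
      \<exists>B'\<subseteq>B. card B \<le> 2 ^ (C * b) * card B' \<and> 2 ^ b * card {w\<in>W. \<not> link_const E w B'} \<le> card W"

section \<open>Linearisation by monomials\<close>

definition bounded_monomials :: "nat \<Rightarrow> ('v \<Rightarrow>\<^sub>0 nat) set" where
  "bounded_monomials t = {m. \<forall>i. Poly_Mapping.lookup m i \<le> t}"

lemma finite_bounded_monomials: "finite (bounded_monomials t :: ('v::finite \<Rightarrow>\<^sub>0 nat) set)"
proof (rule inj_on_finite)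
  show "inj_on Poly_Mapping.lookup (bounded_monomials t :: ('v \<Rightarrow>\<^sub>0 nat) set)"
    by (simp add: inj_on_def)
  show "Poly_Mapping.lookup ` (bounded_monomials t :: ('v \<Rightarrow>\<^sub>0 nat) set) \<subseteq> UNIV \<rightarrow>\<^sub>E {..t}"
    by (auto simp: bounded_monomials_def)
  show "finite ((UNIV :: 'v set) \<rightarrow>\<^sub>E {..t})" by (intro finite_PiE) auto
qed

lemma keys_subset_bounded_monomials:
  fixes f :: "'v::finite real_mpoly"
  assumes "total_degree f \<le> t"
  shows "Poly_Mapping.keys f \<subseteq> bounded_monomials t"
proof
  fix m assume m: "m \<in> Poly_Mapping.keys f"
  have "Poly_Mapping.lookup m i \<le> t" for i
  proof (cases "i \<in> Poly_Mapping.keys m")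
    case True
    then have "Poly_Mapping.lookup m i \<le> (\<Sum>i\<in>Poly_Mapping.keys m. Poly_Mapping.lookup m i)"
      by (intro member_le_sum) auto
    also have "\<dots> \<le> total_degree f" unfolding total_degree_def using m by (intro Max_ge) auto
    finally show ?thesis using assms by simp
  qed (simp add: in_keys_iff)
  then show "m \<in> bounded_monomials t" by (simp add: bounded_monomials_def)
qed

lemma prod_UNIV_sum:
  fixes g :: "'a::finite + 'b::finite \<Rightarrow> 'c::comm_monoid_mult"
  shows "prod g UNIV = prod (\<lambda>i. g (Inl i)) UNIV * prod (\<lambda>i. g (Inr i)) UNIV"
  unfolding UNIV_Plus_UNIV[symmetric] by (subst prod.Plus) (auto simp: comp_def)

text \<open>For fixed \<open>p\<close> and \<open>q\<close> a polynomial is a linear form in the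
  monomials of \<open>r\<close>. The bracketing separates the coefficient from the
  coordinate.\<close>

lemma eval_mpoly_triple_coords:
  fixes f :: "('d::finite + 'd + 'd) real_mpoly" and p q r :: "real ^ 'd"
  assumes deg: "total_degree f \<le> t" and e: "bij_betw e {..<D} (bounded_monomials t)"
  shows "eval_mpoly f (triple_coords p q r) = (\<Sum>i<D. (Poly_Mapping.lookup f (e i) *
           (\<Prod>j\<in>UNIV. p $ j ^ Poly_Mapping.lookup (e i) (Inl j)) *
           (\<Prod>j\<in>UNIV. q $ j ^ Poly_Mapping.lookup (e i) (Inr (Inl j)))) *
           (\<Prod>j\<in>UNIV. r $ j ^ Poly_Mapping.lookup (e i) (Inr (Inr j))))"
proof -
  let ?x = "triple_coords p q r"
  have mon: "(\<Prod>i\<in>Poly_Mapping.keys m. ?x i ^ Poly_Mapping.lookup m i) =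
      (\<Prod>j\<in>UNIV. p $ j ^ Poly_Mapping.lookup m (Inl j)) *
      ((\<Prod>j\<in>UNIV. q $ j ^ Poly_Mapping.lookup m (Inr (Inl j))) *
       (\<Prod>j\<in>UNIV. r $ j ^ Poly_Mapping.lookup m (Inr (Inr j))))" for m
  proof -
    have "(\<Prod>i\<in>Poly_Mapping.keys m. ?x i ^ Poly_Mapping.lookup m i) =
        (\<Prod>i\<in>UNIV. ?x i ^ Poly_Mapping.lookup m i)"
      by (rule prod.mono_neutral_left) (auto simp: in_keys_iff)
    then show ?thesis by (simp add: prod_UNIV_sum triple_coords_def)
  qed
  have "eval_mpoly f ?x = (\<Sum>m\<in>bounded_monomials t. Poly_Mapping.lookup f m *
        (\<Prod>i\<in>Poly_Mapping.keys m. ?x i ^ Poly_Mapping.lookup m i))"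
    unfolding eval_mpoly_def
    using keys_subset_bounded_monomials[OF deg] finite_bounded_monomials
    by (intro sum.mono_neutral_left) (auto simp: in_keys_iff)
  also have "\<dots> = (\<Sum>i<D. Poly_Mapping.lookup f (e i) *
        (\<Prod>j\<in>Poly_Mapping.keys (e i). ?x j ^ Poly_Mapping.lookup (e i) j))"
    by (rule sum.reindex_bij_betw[OF e, symmetric])
  finally show ?thesis by (simp add: mon mult.assoc)
qed

text \<open>The linear forms are indexed by a pair of points and a polynomial; the link of a pair is
  constant once all \<open>t\<close> of its forms have constant sign.\<close>

lemma cutting_if_semialgebraic:
  fixes t :: nat
  obtains C where "\<And>(P :: (real ^ 'd::finite) set) E. finite P \<Longrightarrow> symmetric_semialgebraic3 t P E \<Longrightarrow> cutting P E C"
proof -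
  define D where "D = card (bounded_monomials t :: ('d + 'd + 'd \<Rightarrow>\<^sub>0 nat) set)"
  obtain e :: "nat \<Rightarrow> ('d + 'd + 'd \<Rightarrow>\<^sub>0 nat)" where e: "bij_betw e {..<D} (bounded_monomials t)"
    using ex_bij_betw_nat_finite[OF finite_bounded_monomials] by (auto simp: D_def atLeast0LessThan)
  obtain C where C: "\<And>(u :: ((real ^ 'd) \<times> (real ^ 'd)) \<times> nat \<Rightarrow> nat \<Rightarrow> real) (v :: real ^ 'd \<Rightarrow> nat \<Rightarrow> real).
    halvable C (\<lambda>h b. \<Sum>i<D. u h i * v b i)" using linear_halvable[of D] by blast
  \<comment> \<open>The summand \<open>t\<close> pays for \<open>t\<close> additional rounds, and
    the final 1 makes the constant positive.\<close>
  define C' where "C' = C * (1 + t) + 1"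
  show thesis
  proof (rule that)
    fix P :: "(real ^ 'd) set" and E
    assume finP: "finite P" and "symmetric_semialgebraic3 t P E"
    then obtain fs :: "('d + 'd + 'd) real_mpoly list" and \<Phi> where
      fs: "length fs = t" "\<And>f. f \<in> set fs \<Longrightarrow> total_degree f \<le> t"
      and \<Phi>: "\<And>p q r. p\<in>P \<Longrightarrow> q\<in>P \<Longrightarrow> r\<in>P \<Longrightarrow> distinct [p, q, r] \<Longrightarrow>
           {p, q, r} \<in> E \<longleftrightarrow> \<Phi> (map (\<lambda>f. eval_mpoly f (triple_coords p q r) \<ge> 0) fs)"
      unfolding symmetric_semialgebraic3_def by auto
    define F where "F h r = eval_mpoly (fs ! snd h) (triple_coords (fst (fst h)) (snd (fst h)) r)"
      for h :: "((real ^ 'd) \<times> (real ^ 'd)) \<times> nat" and r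
    \<comment> \<open>The entry \<open>fs ! l\<close> is meaningful only for \<open>l < t\<close>;
      elsewhere the zero form keeps the family linear.\<close>
    have hv: "halvable C (\<lambda>h. if snd h < t then F h else (\<lambda>_. 0))"
    proof -
      have "(\<lambda>h. if snd h < t then F h else (\<lambda>_. 0)) = (\<lambda>h r. \<Sum>i<D. (if snd h < t then Poly_Mapping.lookup (fs ! snd h) (e i) *
           (\<Prod>j\<in>UNIV. fst (fst h) $ j ^ Poly_Mapping.lookup (e i) (Inl j)) *
           (\<Prod>j\<in>UNIV. snd (fst h) $ j ^ Poly_Mapping.lookup (e i) (Inr (Inl j))) else 0) *
           (\<Prod>j\<in>UNIV. r $ j ^ Poly_Mapping.lookup (e i) (Inr (Inr j))))"
        using fs by (intro ext) (auto simp: F_def intro!: eval_mpoly_triple_coords[OF _ e])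
      then show ?thesis using C by simp
    qed
    show "cutting P E C'"
    proof
      show "finite P" by (rule finP)
      show "1 \<le> C'" by (simp add: C'_def)
      fix W :: "((real ^ 'd) \<times> (real ^ 'd)) set" and B :: "(real ^ 'd) set" and b
      assume W: "W \<subseteq> P \<times> P" and B: "B \<subseteq> P"
        and dist: "\<And>x y. (x, y) \<in> W \<Longrightarrow> x \<noteq> y \<and> x \<notin> B \<and> y \<notin> B"
      have fin: "finite W" "finite B" using W B finP finite_subset by blast+
      show "\<exists>B'\<subseteq>B. card B \<le> 2 ^ (C' * b) * card B' \<and> 2 ^ b * card {w\<in>W. \<not> link_const E w B'} \<le> card W"
      proof (cases "b = 0")
        case True
        then show ?thesis using fin by (intro exI[of _ B]) (auto intro: card_mono)
      next
        case False
        let ?H = "W \<times> {..<t}" and ?G = "\<lambda>h. if snd h < t then F h else (\<lambda>_. 0)"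
        \<comment> \<open>The \<open>t\<close> extra rounds compensate for each pair being
          represented \<open>t\<close> times, as \<open>t \<le> 2 ^ t\<close>.\<close>
        obtain B' where B': "B' \<subseteq> B" "card B \<le> 2 ^ (C * (b + t)) * card B'"
          "2 ^ (b + t) * card {h\<in>?H. \<not> const_sign (?G h) B'} \<le> card ?H"
          using halvable_iterate[OF hv, of ?H B "b + t"] fin by auto
        have homI: "link_const E w B'" if w: "w \<in> W" and c: "\<And>l. l < t \<Longrightarrow> const_sign (F (w, l)) B'" for w
        proof -
          have "{fst w, snd w, z} \<in> E \<longleftrightarrow> {fst w, snd w, z'} \<in> E" if z: "z \<in> B'" "z' \<in> B'" for z z'
          proof -
            have d: "distinct [fst w, snd w, z]" "distinct [fst w, snd w, z']"
              using dist[of "fst w" "snd w"] w z B'(1) by auto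
            have mem: "fst w \<in> P" "snd w \<in> P" "z \<in> P" "z' \<in> P" using w W z B' B by auto
            have "0 \<le> F (w, l) z \<longleftrightarrow> 0 \<le> F (w, l) z'" if "l < t" for l
              using c[OF that] z by (force simp: const_sign_def)
            then have "map (\<lambda>f. eval_mpoly f (triple_coords (fst w) (snd w) z) \<ge> 0) fs =
              map (\<lambda>f. eval_mpoly f (triple_coords (fst w) (snd w) z') \<ge> 0) fs"
              using fs(1) by (auto simp: F_def list_eq_iff_nth_eq)
            then show ?thesis using \<Phi>[OF mem(1,2,3) d(1)] \<Phi>[OF mem(1,2,4) d(2)] by (simp only:)
          qed
          then show ?thesis unfolding link_const_def by blast
        qed
        have "{w\<in>W. \<not> link_const E w B'} \<subseteq> fst ` {h\<in>?H. \<not> const_sign (?G h) B'}"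
        proof
          fix w assume w: "w \<in> {w\<in>W. \<not> link_const E w B'}"
          then obtain l where "l < t" "\<not> const_sign (F (w, l)) B'" using homI by blast
          then show "w \<in> fst ` {h\<in>?H. \<not> const_sign (?G h) B'}"
            using w by (intro image_eqI[of _ _ "(w, l)"]) auto
        qed
        then have "card {w\<in>W. \<not> link_const E w B'} \<le> card {h\<in>?H. \<not> const_sign (?G h) B'}"
          using fin by (intro surj_card_le) auto
        then have "2 ^ (b + t) * card {w\<in>W. \<not> link_const E w B'} \<le> 2 ^ (b + t) * card {h\<in>?H. \<not> const_sign (?G h) B'}"
          by (rule mult_le_mono2)
        also have "\<dots> \<le> card W * t"
          using B'(3) unfolding card_cartesian_product card_lessThan .
        also have "\<dots> \<le> card W * 2 ^ t" by (intro mult_le_mono2 less_imp_le less_exp)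
        finally have "2 ^ b * card {w\<in>W. \<not> link_const E w B'} \<le> card W" by (simp add: power_add)
        \<comment> \<open>Here it matters that \<open>b\<close> is positive.\<close>
        moreover have "C * (b + t) \<le> C' * b"
        proof -
          have "t \<le> t * b" using False by simp
          then have "C * (b + t) \<le> C * (b + t * b)" by (intro mult_le_mono2) simp
          also have "\<dots> \<le> C' * b" by (simp add: C'_def algebra_simps)
          finally show ?thesis .
        qed
        then have "card B \<le> 2 ^ (C' * b) * card B'"
          using B'(2) by (elim order_trans) (intro mult_le_mono1 power_increasing, auto)
        ultimately show ?thesis using B'(1) by blast
      qed
    qed
  qed
qed

section \<open>Cographs in links\<close>

definition link_homogeneous :: "'a set set \<Rightarrow> 'a \<Rightarrow> 'a set \<Rightarrow> 'a set \<Rightarrow> bool" where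
  "link_homogeneous E p A B \<longleftrightarrow> (\<forall>x\<in>A. \<forall>y\<in>B. {p, x, y} \<in> E) \<or> (\<forall>x\<in>A. \<forall>y\<in>B. {p, x, y} \<notin> E)"

definition link_indep :: "'a set set \<Rightarrow> 'a \<Rightarrow> 'a set \<Rightarrow> bool" where
  "link_indep E p I \<longleftrightarrow> (\<forall>x\<in>I. \<forall>y\<in>I. x \<noteq> y \<longrightarrow> {p, x, y} \<notin> E)"

definition link_clique :: "'a set set \<Rightarrow> 'a \<Rightarrow> 'a set \<Rightarrow> bool" where
  "link_clique E p K \<longleftrightarrow> (\<forall>x\<in>K. \<forall>y\<in>K. x \<noteq> y \<longrightarrow> {p, x, y} \<in> E)"

text \<open>The decomposition tree is common to the links of all points of \<open>Q\<close>, but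
  whether a node is a join or a disjoint union may differ from link to link.\<close>

inductive cograph :: "'a set set \<Rightarrow> 'a set \<Rightarrow> 'a set \<Rightarrow> bool" for E Q where
  single: "cograph E Q {x}"
| join: "cograph E Q S \<Longrightarrow> cograph E Q T \<Longrightarrow> S \<inter> T = {} \<Longrightarrow> (\<And>p. p \<in> Q \<Longrightarrow> link_homogeneous E p S T)
    \<Longrightarrow> cograph E Q (S \<union> T)"

lemma link_constD: "link_const E (x, y) B \<Longrightarrow> z \<in> B \<Longrightarrow> z' \<in> B \<Longrightarrow> {x, y, z} \<in> E \<longleftrightarrow> {x, y, z'} \<in> E"
  unfolding link_const_def by auto

lemma link_const_subset: "link_const E w B \<Longrightarrow> B' \<subseteq> B \<Longrightarrow> link_const E w B'"
  unfolding link_const_def by blast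

lemma link_homogeneous_subset: "link_homogeneous E p A B \<Longrightarrow> A' \<subseteq> A \<Longrightarrow> B' \<subseteq> B \<Longrightarrow> link_homogeneous E p A' B'"
  unfolding link_homogeneous_def by blast

lemma cograph_finite: "cograph E Q T \<Longrightarrow> finite T"
  by (induction rule: cograph.induct) auto

lemma cograph_mono: "cograph E Q T \<Longrightarrow> Q' \<subseteq> Q \<Longrightarrow> cograph E Q' T"
  by (induction rule: cograph.induct) (auto intro: cograph.intros)

lemma cograph_subset:
  assumes "cograph E Q T" "T' \<subseteq> T" "T' \<noteq> {}"
  shows "cograph E Q T'"
  using assms
proof (induction arbitrary: T' rule: cograph.induct)
  case (single x)
  then have "T' = {x}" by auto
  then show ?case by (simp add: cograph.single)
next
  case (join S T)
  have eq: "T' = (T' \<inter> S) \<union> (T' \<inter> T)" using join.prems by auto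
  show ?case
  proof (cases "T' \<inter> S = {} \<or> T' \<inter> T = {}")
    case True
    then have "T' \<subseteq> S \<or> T' \<subseteq> T" using eq by blast
    then show ?thesis using join by blast
  next
    case False
    have "cograph E Q ((T' \<inter> S) \<union> (T' \<inter> T))"
    proof (rule cograph.join)
      show "cograph E Q (T' \<inter> S)" "cograph E Q (T' \<inter> T)" using join.IH False by auto
      show "(T' \<inter> S) \<inter> (T' \<inter> T) = {}" using join.hyps by blast
      show "link_homogeneous E p (T' \<inter> S) (T' \<inter> T)" if "p \<in> Q" for p
        by (rule link_homogeneous_subset) (use join.hyps that in auto)
    qed
    then show ?thesis using eq by simp
  qed
qed

text \<open>Only the size of \<open>K\<close> is lost when one further link is made independent; this is
  where cographs (as perfect graphs) are better than general semi-algebraic graphs.\<close>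

lemma cograph_indep_clique:
  assumes "cograph E Q T" "p \<in> Q"
  shows "\<exists>I\<subseteq>T. \<exists>K\<subseteq>T. link_indep E p I \<and> link_clique E p K \<and> card T \<le> card I * card K"
  using assms
proof (induction rule: cograph.induct)
  case (single x)
  have "link_indep E p {x}" "link_clique E p {x}" "card {x} \<le> card {x} * card {x}"
    by (auto simp: link_indep_def link_clique_def)
  then show ?case by blast
next
  case (join S T)
  obtain I1 K1 where 1: "I1 \<subseteq> S" "K1 \<subseteq> S" "link_indep E p I1" "link_clique E p K1" "card S \<le> card I1 * card K1"
    using join.IH(1)[OF join.prems] by blast
  obtain I2 K2 where 2: "I2 \<subseteq> T" "K2 \<subseteq> T" "link_indep E p I2" "link_clique E p K2" "card T \<le> card I2 * card K2"
    using join.IH(2)[OF join.prems] by blast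
  have fin: "finite S" "finite T"
    using cograph_finite[OF join.hyps(1)] cograph_finite[OF join.hyps(2)] by auto
  then have fin': "finite I1" "finite I2" "finite K1" "finite K2"
    using 1 2 finite_subset by blast+
  have cST: "card (S \<union> T) = card S + card T" using fin join.hyps by (intro card_Un_disjoint) auto
  have disj: "I1 \<inter> I2 = {}" "K1 \<inter> K2 = {}" using 1 2 join.hyps by blast+
  have sym: "{p, x, y} \<in> E \<longleftrightarrow> {p, y, x} \<in> E" for x y by (simp add: insert_commute)
  consider "\<forall>x\<in>S. \<forall>y\<in>T. {p, x, y} \<in> E" | "\<forall>x\<in>S. \<forall>y\<in>T. {p, x, y} \<notin> E"
    using join unfolding link_homogeneous_def by blast
  then show ?case
  proof cases
    case 1
    \<comment> \<open>At a join the cliques of both parts unite and the larger independent set is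
      kept; at a disjoint union the roles are exchanged.\<close>
    define I where "I = (if card I1 \<le> card I2 then I2 else I1)"
    have I: "card I1 \<le> card I" "card I2 \<le> card I" "I \<subseteq> S \<union> T" "link_indep E p I"
      using \<open>I1 \<subseteq> S\<close> \<open>I2 \<subseteq> T\<close> \<open>link_indep E p I1\<close> \<open>link_indep E p I2\<close> by (auto simp: I_def)
    have K: "link_clique E p (K1 \<union> K2)"
      unfolding link_clique_def
    proof (intro ballI impI)
      fix x y assume "x \<in> K1 \<union> K2" "y \<in> K1 \<union> K2" "x \<noteq> y"
      then show "{p, x, y} \<in> E"
        using 1 \<open>link_clique E p K1\<close> \<open>link_clique E p K2\<close> \<open>K1 \<subseteq> S\<close> \<open>K2 \<subseteq> T\<close> sym[of x y]
        unfolding link_clique_def by blast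
    qed
    have "card (S \<union> T) \<le> card I1 * card K1 + card I2 * card K2"
      using \<open>card S \<le> _\<close> \<open>card T \<le> _\<close> cST by linarith
    also have "\<dots> \<le> card I * card K1 + card I * card K2" using I by (intro add_mono mult_le_mono1)
    also have "\<dots> = card I * card (K1 \<union> K2)" using fin' disj by (simp add: card_Un_disjoint distrib_left)
    finally show ?thesis using I K \<open>K1 \<subseteq> S\<close> \<open>K2 \<subseteq> T\<close>
      by (intro exI[of _ I] exI[of _ "K1 \<union> K2"] conjI) auto
  next
    case 2
    define K where "K = (if card K1 \<le> card K2 then K2 else K1)"
    have K: "card K1 \<le> card K" "card K2 \<le> card K" "K \<subseteq> S \<union> T" "link_clique E p K"
      using \<open>K1 \<subseteq> S\<close> \<open>K2 \<subseteq> T\<close> \<open>link_clique E p K1\<close> \<open>link_clique E p K2\<close> by (auto simp: K_def)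
    have I: "link_indep E p (I1 \<union> I2)"
      unfolding link_indep_def
    proof (intro ballI impI)
      fix x y assume "x \<in> I1 \<union> I2" "y \<in> I1 \<union> I2" "x \<noteq> y"
      then show "{p, x, y} \<notin> E"
        using 2 \<open>link_indep E p I1\<close> \<open>link_indep E p I2\<close> \<open>I1 \<subseteq> S\<close> \<open>I2 \<subseteq> T\<close> sym[of x y]
        unfolding link_indep_def by blast
    qed
    have "card (S \<union> T) \<le> card I1 * card K1 + card I2 * card K2"
      using \<open>card S \<le> _\<close> \<open>card T \<le> _\<close> cST by linarith
    also have "\<dots> \<le> card I1 * card K + card I2 * card K" using K by (intro add_mono mult_le_mono2)
    also have "\<dots> = card (I1 \<union> I2) * card K" using fin' disj by (simp add: card_Un_disjoint distrib_right)
    finally show ?thesis using I K \<open>I1 \<subseteq> S\<close> \<open>I2 \<subseteq> T\<close>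
      by (intro exI[of _ "I1 \<union> I2"] exI[of _ K] conjI) auto
  qed
qed

lemma cograph_nonempty: "cograph E Q T \<Longrightarrow> T \<noteq> {}"
  by (induction rule: cograph.induct) auto

text \<open>Induced subgraphs of cographs are cographs, so the links can be made independent one
  after the other, each at the cost of a factor \<open>w\<close>.\<close>

lemma cograph_link_indep_all:
  assumes "finite Q" "cograph E Q T"
    and "\<And>p K. p \<in> Q \<Longrightarrow> K \<subseteq> T \<Longrightarrow> link_clique E p K \<Longrightarrow> card K \<le> w"
  shows "\<exists>I\<subseteq>T. card T \<le> card I * w ^ card Q \<and> (\<forall>p\<in>Q. link_indep E p I)"
  using assms
proof (induction Q arbitrary: T rule: finite_induct)
  case empty
  then show ?case by auto
next
  case (insert p Q)
  obtain I0 K0 where I0: "I0 \<subseteq> T" "K0 \<subseteq> T" "link_indep E p I0" "link_clique E p K0" "card T \<le> card I0 * card K0"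
    using cograph_indep_clique[OF insert.prems(1), of p] by auto
  have "card K0 \<le> w" using insert.prems(2) I0 by blast
  then have "card T \<le> card I0 * w" using I0(5) by (meson le_trans mult_le_mono2)
  have T: "finite T" "T \<noteq> {}" using insert.prems(1) cograph_finite cograph_nonempty by blast+
  then have "card I0 * w > 0" using \<open>card T \<le> card I0 * w\<close> by (metis card_gt_0_iff gr0I le_zero_eq)
  then have "I0 \<noteq> {}" by auto
  then have "cograph E Q I0"
    using cograph_subset[OF insert.prems(1) I0(1)] cograph_mono by blast
  then obtain I where I: "I \<subseteq> I0" "card I0 \<le> card I * w ^ card Q" "\<forall>p\<in>Q. link_indep E p I"
    using insert.IH[of I0] insert.prems(2) I0(1) by (meson insertI2 order_trans)
  have "card T \<le> (card I * w ^ card Q) * w"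
    using \<open>card T \<le> card I0 * w\<close> I(2) by (meson le_trans mult_le_mono1)
  moreover have "link_indep E p I" using I0(3) I(1) unfolding link_indep_def by blast
  ultimately show ?case using I I0(1) insert.hyps
    by (intro exI[of _ I]) (auto simp: ac_simps)
qed

section \<open>Cographs from repeated cutting\<close>

context cutting
begin

lemma finite_sub: "S \<subseteq> P \<Longrightarrow> finite S"
  using finite_P finite_subset by blast

text \<open>At most |W| / 2^b < 1 pairs remain bad.\<close>

lemma cut_all:
  assumes "W \<subseteq> P \<times> P" "B \<subseteq> P" "\<And>x y. (x, y) \<in> W \<Longrightarrow> x \<noteq> y \<and> x \<notin> B \<and> y \<notin> B"
    and "card W < 2 ^ b"
  shows "\<exists>B'\<subseteq>B. card B \<le> 2 ^ (C * b) * card B' \<and> (\<forall>w\<in>W. link_const E w B')"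
proof -
  obtain B' where B': "B' \<subseteq> B" "card B \<le> 2 ^ (C * b) * card B'"
    "2 ^ b * card {w\<in>W. \<not> link_const E w B'} \<le> card W"
    using cut[OF assms(1-3), of b] by blast
  have fW: "finite W" using assms(1) finite_P finite_subset by blast
  have "card {w\<in>W. \<not> link_const E w B'} = 0"
  proof (rule ccontr)
    assume "\<not> ?thesis"
    then have "2 ^ b * 1 \<le> 2 ^ b * card {w\<in>W. \<not> link_const E w B'}" by (intro mult_le_mono2) simp
    then show False using B'(3) assms(4) by linarith
  qed
  then have "\<forall>w\<in>W. link_const E w B'" using fW by auto
  then show ?thesis using B' by blast
qed

text \<open>First \<open>B\<close> is cut so that at least half of \<open>A\<close> forms only good
  pairs with all of \<open>Q\<close>. Then a single \<open>y0\<close> in \<open>B'\<close>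
  represents the whole of \<open>B'\<close>, and it suffices to cut the rest of \<open>A\<close> by
  the pairs \<open>(p, y0)\<close>.\<close>

lemma ex_link_homogeneous:
  assumes "Q \<subseteq> P" "A \<subseteq> P" "B \<subseteq> P" "Q \<inter> A = {}" "Q \<inter> B = {}" "A \<inter> B = {}" "B \<noteq> {}"
    and "card Q \<le> 2 ^ q"
  shows "\<exists>A'\<subseteq>A. \<exists>B'\<subseteq>B. card A \<le> 2 ^ (C * (q + 1) + 1) * card A' \<and>
     card B \<le> 2 ^ (C * (q + 1) + 1) * card B' \<and> (\<forall>p\<in>Q. link_homogeneous E p A' B')"
proof -
  have "\<exists>B'\<subseteq>B. card B \<le> 2 ^ (C * (q + 1)) * card B' \<and>
      2 ^ (q + 1) * card {w \<in> Q \<times> A. \<not> link_const E w B'} \<le> card (Q \<times> A)"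
    by (rule cut) (use assms in auto)
  then obtain B' where B': "B' \<subseteq> B" "card B \<le> 2 ^ (C * (q + 1)) * card B'"
    "2 ^ (q + 1) * card {w \<in> Q \<times> A. \<not> link_const E w B'} \<le> card (Q \<times> A)" by blast
  define bad where "bad = {w \<in> Q \<times> A. \<not> link_const E w B'}"
  \<comment> \<open>The points in a bad pair are dropped. The extra round in \<open>q + 1\<close>
    ensures that they are at most half of \<open>A\<close>.\<close>
  define A1 where "A1 = A - snd ` bad"
  have fin: "finite A" "finite Q" "finite B" "finite bad"
    using assms finite_sub by (auto simp: bad_def)
  have "2 ^ q * (2 * card bad) \<le> card Q * card A"
    using B'(3) by (simp add: bad_def card_cartesian_product)
  also have "\<dots> \<le> 2 ^ q * card A" using assms(8) by (rule mult_le_mono1)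
  finally have "2 * card (snd ` bad) \<le> card A" using card_image_le[OF fin(4), of snd] by simp
  moreover have "card A1 = card A - card (snd ` bad)"
    unfolding A1_def using fin by (intro card_Diff_subset) (auto simp: bad_def)
  ultimately have A1: "card A \<le> 2 * card A1" by linarith
  have "card B' \<noteq> 0" using B'(2) fin assms(7) by (metis card_0_eq le_zero_eq mult_0_right)
  then obtain y0 where y0: "y0 \<in> B'" by fastforce
  have "card (Q \<times> {y0}) = card Q" by (simp add: card_cartesian_product)
  also have "\<dots> < 2 ^ (q + 1)" using assms(8) by (simp add: le_less_trans)
  finally have cW: "card (Q \<times> {y0}) < 2 ^ (q + 1)" .
  have "\<exists>A'\<subseteq>A1. card A1 \<le> 2 ^ (C * (q + 1)) * card A' \<and> (\<forall>w\<in>Q \<times> {y0}. link_const E w A')"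
    by (rule cut_all[OF _ _ _ cW]) (use assms y0 B' in \<open>auto simp: A1_def\<close>)
  then obtain A' where A': "A' \<subseteq> A1" "card A1 \<le> 2 ^ (C * (q + 1)) * card A'"
    "\<And>p. p \<in> Q \<Longrightarrow> link_const E (p, y0) A'" by blast
  have "link_homogeneous E p A' B'" if p: "p \<in> Q" for p
  proof -
    have "{p, x, y} \<in> E \<longleftrightarrow> {p, x', y'} \<in> E" if "x \<in> A'" "y \<in> B'" "x' \<in> A'" "y' \<in> B'" for x y x' y'
    proof -
      have *: "link_const E (p, x) B'" if "x \<in> A'" for x
      proof (rule ccontr)
        assume "\<not> link_const E (p, x) B'"
        then have "(p, x) \<in> bad" using p that A'(1) by (auto simp: bad_def A1_def)
        then have "x \<in> snd ` bad" by force
        then show False using that A'(1) by (auto simp: A1_def)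
      qed
      have "{p, x, y} \<in> E \<longleftrightarrow> {p, x, y0} \<in> E" using link_constD[OF *] that y0 by blast
      also have "\<dots> \<longleftrightarrow> {p, y0, x'} \<in> E"
        using link_constD[OF A'(3)[OF p], of x x'] that by (simp add: insert_commute)
      also have "\<dots> \<longleftrightarrow> {p, x', y'} \<in> E"
        using link_constD[OF *, of x' y0 y'] that y0 by (simp add: insert_commute)
      finally show ?thesis .
    qed
    then show ?thesis unfolding link_homogeneous_def by meson
  qed
  moreover have "card A \<le> 2 ^ (C * (q + 1) + 1) * card A'"
    using A1 A'(2) by simp
  moreover have "card B \<le> 2 ^ (C * (q + 1) + 1) * card B'" using B'(2) by simp
  moreover have "A' \<subseteq> A" using A'(1) by (auto simp: A1_def)
  ultimately show ?thesis using B'(1) by blast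
qed

text \<open>Split into halves, make two large subsets homogeneous to each other for all of
  \<open>Q\<close>, and recurse into both. A level costs \<open>C * (q + 1) + 1\<close> bits for
  homogeneity and one bit for the split.\<close>

lemma ex_cograph:
  assumes "Q \<subseteq> P" "S \<subseteq> P" "Q \<inter> S = {}" "card Q \<le> 2 ^ q" "2 ^ (h * (C * (q + 1) + 2)) \<le> card S"
  shows "\<exists>T\<subseteq>S. cograph E Q T \<and> 2 ^ h \<le> card T"
  using assms(2-)
proof (induction h arbitrary: S)
  case 0
  then obtain x where "x \<in> S" by fastforce
  then show ?case by (intro exI[of _ "{x}"]) (auto intro: cograph.single)
next
  case (Suc h)
  define k where "k = C * (q + 1) + 1"
  define m :: nat where "m = 2 ^ (k + h * (k + 1))"
  have "2 ^ (Suc h * (C * (q + 1) + 2)) = 2 * m"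
    by (simp add: m_def k_def power_add algebra_simps)
  then have m: "2 * m \<le> card S" using Suc.prems by simp
  then obtain A where A: "A \<subseteq> S" "card A = m"
    by (metis obtain_subset_with_card_n le_add1 le_trans mult_2)
  have fS: "finite S" using Suc.prems finite_sub by blast
  have "card (S - A) = card S - m" using A fS by (metis card_Diff_subset finite_subset)
  then have B: "m \<le> card (S - A)" using m by simp
  have "m > 0" by (simp add: m_def)
  then have "S - A \<noteq> {}" using B by (metis card.empty not_less)
  then have "\<exists>A'\<subseteq>A. \<exists>B'\<subseteq>S - A. card A \<le> 2 ^ k * card A' \<and> card (S - A) \<le> 2 ^ k * card B' \<and>
      (\<forall>p\<in>Q. link_homogeneous E p A' B')"
    unfolding k_def using Suc.prems A by (intro ex_link_homogeneous assms(1)) auto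
  then obtain A' B' where AB: "A' \<subseteq> A" "B' \<subseteq> S - A" "card A \<le> 2 ^ k * card A'"
    "card (S - A) \<le> 2 ^ k * card B'" "\<forall>p\<in>Q. link_homogeneous E p A' B'" by blast
  have kk: "C * (q + 1) + 2 = k + 1" by (simp add: k_def)
  have ge: "2 ^ (h * (C * (q + 1) + 2)) \<le> card A'" "2 ^ (h * (C * (q + 1) + 2)) \<le> card B'"
    using A(2) AB(3) order_trans[OF B AB(4)] unfolding kk m_def by (simp_all add: power_add)
  have sub: "A' \<subseteq> P" "B' \<subseteq> P" "Q \<inter> A' = {}" "Q \<inter> B' = {}"
    using Suc.prems(1,2) A(1) AB(1,2) by blast+
  obtain T1 where T1: "T1 \<subseteq> A'" "cograph E Q T1" "2 ^ h \<le> card T1"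
    using Suc.IH[OF sub(1,3) Suc.prems(3) ge(1)] by blast
  obtain T2 where T2: "T2 \<subseteq> B'" "cograph E Q T2" "2 ^ h \<le> card T2"
    using Suc.IH[OF sub(2,4) Suc.prems(3) ge(2)] by blast
  have disj: "T1 \<inter> T2 = {}" using T1 T2 AB(1,2) by blast
  have "cograph E Q (T1 \<union> T2)"
  proof (rule cograph.join[OF T1(2) T2(2) disj])
    show "link_homogeneous E p T1 T2" if "p \<in> Q" for p
      using AB(5) that by (intro link_homogeneous_subset[OF _ T1(1) T2(1)]) blast
  qed
  moreover have "card (T1 \<union> T2) = card T1 + card T2"
    using disj T1 T2 cograph_finite by (intro card_Un_disjoint) auto
  ultimately show ?case using T1 T2 A AB by (intro exI[of _ "T1 \<union> T2"]) auto
qed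

end

section \<open>Homogeneous blocks\<close>

text \<open>Each alternative replaces one point by \<open>z\<close>. Admitting all three makes the
  notion independent of the order of the points, so the order of the greedy sequence need not be
  recorded.\<close>

definition decided :: "'a set set \<Rightarrow> 'a \<Rightarrow> 'a \<Rightarrow> 'a \<Rightarrow> 'a \<Rightarrow> bool" where
  "decided E z a b c \<longleftrightarrow> ({a, b, c} \<in> E \<longleftrightarrow> {a, b, z} \<in> E) \<or>
     ({a, b, c} \<in> E \<longleftrightarrow> {a, c, z} \<in> E) \<or> ({a, b, c} \<in> E \<longleftrightarrow> {b, c, z} \<in> E)"

lemma decided_swap:
  "decided E z a b c \<Longrightarrow> decided E z b a c" "decided E z a b c \<Longrightarrow> decided E z b c a"
  by (auto simp: decided_def insert_commute)

lemma clique_free3_subset: "clique_free3 s P E \<Longrightarrow> X \<subseteq> P \<Longrightarrow> clique_free3 s X E"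
  unfolding clique_free3_def nsets_def by blast

lemma nsets_3_iff: "e \<in> nsets A 3 \<longleftrightarrow> (\<exists>x\<in>A. \<exists>y\<in>A. \<exists>z\<in>A. e = {x, y, z} \<and> x \<noteq> y \<and> y \<noteq> z \<and> x \<noteq> z)"
proof
  assume "e \<in> nsets A 3"
  then have "card e = 3" "e \<subseteq> A" by (auto simp: nsets_def)
  then show "\<exists>x\<in>A. \<exists>y\<in>A. \<exists>z\<in>A. e = {x, y, z} \<and> x \<noteq> y \<and> y \<noteq> z \<and> x \<noteq> z"
    unfolding card_3_iff by auto
qed (auto simp: nsets_def)

lemma power2_le_cancel: "2 ^ (a + c) \<le> (n::nat) \<Longrightarrow> n \<le> 2 ^ c * k \<Longrightarrow> 2 ^ a \<le> k"
proof -
  assume "2 ^ (a + c) \<le> n" "n \<le> 2 ^ c * k"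
  then have "2 ^ (a + c) \<le> 2 ^ c * k" by (rule le_trans)
  then show ?thesis by (simp add: power_add mult.commute)
qed

lemma ex_disjoint_blocks:
  assumes "finite S" "n * k \<le> card S"
  shows "\<exists>A. (\<forall>i<n. A i \<subseteq> S \<and> card (A i) = k) \<and> (\<forall>i<n. \<forall>j<n. i \<noteq> j \<longrightarrow> A i \<inter> A j = {})"
  using assms
proof (induction n arbitrary: S)
  case 0
  then show ?case by simp
next
  case (Suc n)
  obtain X where X: "X \<subseteq> S" "card X = k"
    using obtain_subset_with_card_n[of k S] Suc.prems by auto
  have "card (S - X) = card S - k" using X Suc.prems by (metis card_Diff_subset finite_subset)
  then have "n * k \<le> card (S - X)" using Suc.prems by simp
  then obtain A where A: "\<forall>i<n. A i \<subseteq> S - X \<and> card (A i) = k"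
    "\<forall>i<n. \<forall>j<n. i \<noteq> j \<longrightarrow> A i \<inter> A j = {}" using Suc.IH[of "S - X"] Suc.prems by auto
  show ?case
    using A X by (intro exI[of _ "A(n := X)"]) (auto simp: less_Suc_eq)
qed

section \<open>Greedy sequences and a Ramsey bound polynomial in the logarithm\<close>

context cutting
begin

text \<open>In the sequence that the greedy procedure builds, a triple is decided by its first two points, so
  that it can be read off the link of the last point \<open>z\<close>.\<close>

lemma erdos_rado:
  assumes "Q \<subseteq> P" "S \<subseteq> P" "Q \<inter> S = {}" "card Q + l \<le> 2 ^ b" "2 ^ (l * (C * b + 1)) \<le> card S"
  shows "\<exists>Y\<subseteq>S. \<exists>z\<in>S - Y. card Y = l \<and>
    (\<forall>a\<in>Q \<union> Y. \<forall>y\<in>Y. \<forall>w\<in>Y. distinct [a, y, w] \<longrightarrow> decided E z a y w)"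
  using assms
proof (induction l arbitrary: Q S)
  case 0
  then have "S \<noteq> {}" by auto
  then show ?case by (intro exI[of _ "{}"]) auto
next
  case (Suc l)
  have fin: "finite S" "finite Q" using Suc.prems finite_sub by auto
  \<comment> \<open>One step costs \<open>C * b\<close> bits for the cut and one bit for removing
    \<open>p\<close>.\<close>
  have big: "2 * 2 ^ (l * (C * b + 1) + C * b) \<le> card S"
    using Suc.prems(5) by (simp add: power_add algebra_simps)
  have "(1::nat) \<le> 2 ^ (l * (C * b + 1) + C * b)" by simp
  then have "2 \<le> card S" using big by linarith
  then obtain p where p: "p \<in> S" by fastforce
  define S0 where "S0 = S - {p}"
  have "card S0 = card S - 1" using p fin by (simp add: S0_def)
  then have S0: "2 ^ (l * (C * b + 1) + C * b) \<le> card S0"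
    using big \<open>(1::nat) \<le> 2 ^ (l * (C * b + 1) + C * b)\<close> by linarith
  have cQ: "card (Q \<times> {p}) < 2 ^ b" using Suc.prems(4) by (simp add: card_cartesian_product)
  \<comment> \<open>From here on the triples through \<open>p\<close> and a point of
    \<open>Q\<close> are constant on all that remains, including the eventual
    \<open>z\<close>.\<close>
  have "\<exists>S1\<subseteq>S0. card S0 \<le> 2 ^ (C * b) * card S1 \<and> (\<forall>w\<in>Q \<times> {p}. link_const E w S1)"
    by (rule cut_all[OF _ _ _ cQ]) (use Suc.prems p in \<open>auto simp: S0_def\<close>)
  then obtain S1 where S1: "S1 \<subseteq> S0" "card S0 \<le> 2 ^ (C * b) * card S1"
    "\<And>q. q \<in> Q \<Longrightarrow> link_const E (q, p) S1" by blast
  have sub: "insert p Q \<subseteq> P" "S1 \<subseteq> P" "insert p Q \<inter> S1 = {}"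
    using Suc.prems p S1(1) by (auto simp: S0_def)
  \<comment> \<open>The point \<open>p\<close> moves from the budget \<open>l\<close> into
    \<open>Q\<close>, so the same \<open>b\<close> serves at every step.\<close>
  have "card (insert p Q) + l \<le> 2 ^ b"
    using Suc.prems(4) card_insert_le_m1[of "Suc (card Q)" Q p] by simp
  then obtain Y z where Y: "Y \<subseteq> S1" "z \<in> S1 - Y" "card Y = l"
    and dec: "\<And>a y w. a \<in> insert p Q \<union> Y \<Longrightarrow> y \<in> Y \<Longrightarrow> w \<in> Y \<Longrightarrow> distinct [a, y, w] \<Longrightarrow> decided E z a y w"
    using Suc.IH[OF sub _ power2_le_cancel[OF S0 S1(2)]] by blast
  have pY: "p \<notin> Y" "p \<noteq> z" using Y S1(1) by (auto simp: S0_def)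
  have "finite Y" using Y(1) sub(2) finite_sub by auto
  then have "card (insert p Y) = Suc l" using pY Y(3) by simp
  moreover have new: "decided E z a p w" if "a \<in> Q" "w \<in> Y" for a w
    using link_constD[OF S1(3)[OF that(1)], of w z] that Y by (auto simp: decided_def)
  have "decided E z a y w"
    if a: "a \<in> Q \<union> insert p Y" and y: "y \<in> insert p Y" and w: "w \<in> insert p Y" and d: "distinct [a, y, w]"
    for a y w
  proof (cases "y = p \<or> w = p")
    case False
    then show ?thesis using dec a y w d by blast
  next
    case True
    show ?thesis
    proof (cases "a \<in> Q")
      case True
      then show ?thesis using \<open>y = p \<or> w = p\<close> new[of a y] new[of a w] y w d
        by (auto intro: decided_swap)
    next
      case False
      \<comment> \<open>In the induction hypothesis the first point ranges over
        \<open>insert p Q\<close>, so \<open>p\<close> is put first and the triple is permuted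
        afterwards.\<close>
      then have "decided E z p a w \<or> decided E z p a y"
        using dec[of p a w] dec[of p a y] a y w d True by auto
      then show ?thesis
        using dec[of p a w] dec[of p a y] a y w d True False by (auto intro: decided_swap)
    qed
  qed
  ultimately show ?case using Y S1(1) p pY
    by (intro exI[of _ "insert p Y"] conjI bexI[of _ z]) (auto simp: S0_def)
qed

text \<open>All triples of \<open>Y\<close> are governed by the link graph of the single point
  \<open>z\<close>. Inside \<open>Y\<close> a clique of that graph is a clique of \<open>E\<close>,
  hence has at most \<open>s\<close> points, and a cograph with small cliques has a large
  independent set, which is then free of edges of \<open>E\<close>.\<close>

lemma ramsey_poly_log:
  assumes X: "X \<subseteq> P" and cf: "clique_free3 s X E"
    and big: "2 ^ (2 ^ (h * (C + 2)) * (C * (h * (C + 2) + 1) + 1)) \<le> card X"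
  shows "\<exists>I\<subseteq>X. nsets I 3 \<inter> E = {} \<and> 2 ^ h \<le> card I * s"
proof -
  obtain Y z where Y: "Y \<subseteq> X" "z \<in> X - Y" "card Y = 2 ^ (h * (C + 2))"
    and dec: "\<And>a y w. a \<in> Y \<Longrightarrow> y \<in> Y \<Longrightarrow> w \<in> Y \<Longrightarrow> distinct [a, y, w] \<Longrightarrow> decided E z a y w"
    using erdos_rado[of "{}" X "2 ^ (h * (C + 2))" "h * (C + 2) + 1"] X big by auto
  obtain T where T: "T \<subseteq> Y" "cograph E {z} T" "2 ^ h \<le> card T"
    using ex_cograph[of "{z}" Y 0 h] Y X by auto
  have cl: "card K \<le> s" if K: "K \<subseteq> T" "link_clique E z K" for K
  proof (rule ccontr)
    assume "\<not> card K \<le> s"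
    then obtain K' where K': "K' \<subseteq> K" "card K' = s" by (meson nat_le_linear obtain_subset_with_card_n)
    have "finite K'" using K' K T Y X finite_sub by (meson order_trans)
    then have "K' \<in> nsets X s" using K' K T Y by (auto simp: nsets_def)
    then obtain e where e: "e \<in> nsets K' 3" "e \<notin> E" using cf by (auto simp: clique_free3_def)
    then obtain a b c where abc: "a \<in> K'" "b \<in> K'" "c \<in> K'" "e = {a, b, c}" "a \<noteq> b" "b \<noteq> c" "a \<noteq> c"
      by (auto simp: nsets_3_iff)
    then have "decided E z a b c" using dec[of a b c] K' K T by auto
    moreover have "{a, b, z} \<in> E" "{a, c, z} \<in> E" "{b, c, z} \<in> E"
      using K(2) abc K'(1) unfolding link_clique_def by (auto simp: insert_commute)
    ultimately show False using e abc by (simp add: decided_def)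
  qed
  obtain I where I: "I \<subseteq> T" "card T \<le> card I * s ^ card {z}" "link_indep E z I"
    using cograph_link_indep_all[OF _ T(2), of s] cl by auto
  have "nsets I 3 \<inter> E = {}"
  proof (rule equals0I)
    fix e assume "e \<in> nsets I 3 \<inter> E"
    then obtain a b c where abc: "a \<in> I" "b \<in> I" "c \<in> I" "e = {a, b, c}" "a \<noteq> b" "b \<noteq> c" "a \<noteq> c" "e \<in> E"
      by (auto simp: nsets_3_iff)
    then have "decided E z a b c" using dec[of a b c] I T by auto
    moreover have "{a, b, z} \<notin> E" "{a, c, z} \<notin> E" "{b, c, z} \<notin> E"
      using I(3) abc unfolding link_indep_def by (auto simp: insert_commute)
    ultimately show False using abc by (simp add: decided_def)
  qed
  then show ?thesis using I T Y by (intro exI[of _ I]) auto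
qed

section \<open>Making triples depend on their blocks only\<close>

lemma homogenize_on_later_blocks:
  fixes n :: nat
  assumes "\<And>i. i < n \<Longrightarrow> A i \<subseteq> P" "\<And>i. i < n \<Longrightarrow> 2 ^ a \<le> card (A i)"
    and "\<And>i j. i < n \<Longrightarrow> j < n \<Longrightarrow> i \<noteq> j \<Longrightarrow> A i \<inter> A j = {}"
    and "n \<le> 2 ^ m" "a' + C * (2 * (m + a') + 1) \<le> a"
  shows "\<exists>B. (\<forall>i<n. B i \<subseteq> A i \<and> card (B i) = 2 ^ a') \<and>
    (\<forall>k<n. \<forall>i<k. \<forall>j<k. \<forall>x\<in>B i. \<forall>y\<in>B j. x \<noteq> y \<longrightarrow> link_const E (x, y) (B k))"
  using assms
proof (induction n)
  case 0
  then show ?case by simp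
next
  case (Suc n)
  have "\<exists>B. (\<forall>i<n. B i \<subseteq> A i \<and> card (B i) = 2 ^ a') \<and>
    (\<forall>k<n. \<forall>i<k. \<forall>j<k. \<forall>x\<in>B i. \<forall>y\<in>B j. x \<noteq> y \<longrightarrow> link_const E (x, y) (B k))"
    by (rule Suc.IH) (use Suc.prems in auto)
  then obtain B where B0: "\<forall>i<n. B i \<subseteq> A i \<and> card (B i) = 2 ^ a'"
    "\<forall>k<n. \<forall>i<k. \<forall>j<k. \<forall>x\<in>B i. \<forall>y\<in>B j. x \<noteq> y \<longrightarrow> link_const E (x, y) (B k)"
    by (elim exE conjE)
  note B = B0(1)[rule_format, THEN conjunct1] B0(1)[rule_format, THEN conjunct2] B0(2)[rule_format]
  define U where "U = (\<Union>i<n. B i)"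
  define W where "W = {w \<in> U \<times> U. fst w \<noteq> snd w}"
  \<comment> \<open>The earlier blocks together have at most \<open>2 ^ (m + a')\<close> points, so
    \<open>2 ^ b\<close> exceeds the number of their pairs.\<close>
  define b where "b = 2 * (m + a') + 1"
  have "B i \<subseteq> P" if "i < n" for i using B(1)[OF that] Suc.prems(1)[of i] that by auto
  then have UP: "U \<subseteq> P" by (auto simp: U_def)
  have "card U \<le> (\<Sum>i<n. card (B i))" unfolding U_def by (intro card_UN_le) simp
  also have "\<dots> = n * 2 ^ a'" using B(2) by simp
  also have "\<dots> \<le> 2 ^ (m + a')" using Suc.prems(4) by (simp add: power_add)
  finally have cU: "card U \<le> 2 ^ (m + a')" .
  have "card W \<le> card (U \<times> U)" unfolding W_def using UP finite_sub by (intro card_mono) auto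
  also have "\<dots> \<le> 2 ^ (m + a') * 2 ^ (m + a')"
    unfolding card_cartesian_product using cU by (intro mult_le_mono)
  also have "\<dots> = 2 ^ (2 * (m + a'))" by (simp add: power_add mult_2)
  also have "\<dots> < 2 ^ b" by (simp add: b_def)
  finally have cW: "card W < 2 ^ b" .
  have An: "A n \<subseteq> P" "2 ^ (a' + C * b) \<le> card (A n)"
  proof -
    show "A n \<subseteq> P" using Suc.prems(1) by simp
    have "(2::nat) ^ (a' + C * b) \<le> 2 ^ a" using Suc.prems(5) by (intro power_increasing) (auto simp: b_def)
    also have "\<dots> \<le> card (A n)" using Suc.prems(2) by simp
    finally show "2 ^ (a' + C * b) \<le> card (A n)" .
  qed
  have UA: "U \<inter> A n = {}"
  proof -
    have "B i \<inter> A n = {}" if "i < n" for i using B(1)[OF that] Suc.prems(3)[of i n] that by auto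
    then show ?thesis by (auto simp: U_def)
  qed
  have "\<exists>B'\<subseteq>A n. card (A n) \<le> 2 ^ (C * b) * card B' \<and> (\<forall>w\<in>W. link_const E w B')"
    by (rule cut_all[OF _ An(1) _ cW]) (use UP UA in \<open>auto simp: W_def\<close>)
  then obtain B' where B': "B' \<subseteq> A n" "card (A n) \<le> 2 ^ (C * b) * card B'" "\<And>w. w \<in> W \<Longrightarrow> link_const E w B'" by blast
  \<comment> \<open>Trimming to an exact size keeps the number of pairs bounded when the following
    blocks are cut.\<close>
  obtain B'' where B'': "B'' \<subseteq> B'" "card B'' = 2 ^ a'" "finite B''"
    by (rule obtain_subset_with_card_n[OF power2_le_cancel[OF An(2) B'(2)]])
  have homW: "link_const E (x, y) B''" if "i < n" "j < n" "x \<in> B i" "y \<in> B j" "x \<noteq> y" for i j x y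
  proof -
    have "(x, y) \<in> W" using that by (auto simp: W_def U_def)
    then show ?thesis using B'(3) B''(1) link_const_subset by blast
  qed
  show ?case
  proof (intro exI[of _ "B(n := B'')"] conjI allI impI ballI)
    fix i assume "i < Suc n"
    then show "(B(n := B'')) i \<subseteq> A i" "card ((B(n := B'')) i) = 2 ^ a'"
      using B(1,2) B'(1) B'' by (auto simp: less_Suc_eq)
  next
    fix k i j x y assume "k < Suc n" "i < k" "j < k" "x \<in> (B(n := B'')) i" "y \<in> (B(n := B'')) j" "x \<noteq> y"
    then show "link_const E (x, y) ((B(n := B'')) k)"
      using homW[of i j x y] B(3)[of k i j x y] by (cases "k = n") auto
  qed
qed

text \<open>Three passes. Cutting forwards lets the last point of a transversal triple move to a
  representative, cutting backwards lets the first point move. The middle point then has to be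
  compared against pairs of representatives only, which takes one cheap cut.\<close>

lemma homogeneous_blocks:
  fixes n :: nat
  assumes AP: "\<And>i. i < n \<Longrightarrow> A i \<subseteq> P" and cA: "\<And>i. i < n \<Longrightarrow> 2 ^ a \<le> card (A i)"
    and disj: "\<And>i j. i < n \<Longrightarrow> j < n \<Longrightarrow> i \<noteq> j \<Longrightarrow> A i \<inter> A j = {}"
    and nm: "n \<le> 2 ^ m"
    and a: "a1 + C * (2 * (m + a1) + 1) \<le> a" "a2 + C * (2 * (m + a2) + 1) \<le> a1" "a3 + C * (2 * m + 1) \<le> a2"
  shows "\<exists>B. (\<forall>i<n. B i \<subseteq> A i \<and> 2 ^ a3 \<le> card (B i)) \<and>
    (\<forall>i<n. \<forall>k<n. i \<noteq> k \<longrightarrow> (\<forall>x\<in>B i. \<forall>y\<in>B i. x \<noteq> y \<longrightarrow> link_const E (x, y) (B k))) \<and>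
    (\<forall>i<n. \<forall>j<n. \<forall>k<n. i \<noteq> j \<longrightarrow> j \<noteq> k \<longrightarrow> i \<noteq> k \<longrightarrow>
       (\<forall>x\<in>B i. \<forall>x'\<in>B i. \<forall>y\<in>B j. \<forall>y'\<in>B j. \<forall>z\<in>B k. \<forall>z'\<in>B k. {x, y, z} \<in> E \<longleftrightarrow> {x', y', z'} \<in> E))"
proof -
  have "\<exists>B. (\<forall>i<n. B i \<subseteq> A i \<and> card (B i) = 2 ^ a1) \<and>
    (\<forall>k<n. \<forall>i<k. \<forall>j<k. \<forall>x\<in>B i. \<forall>y\<in>B j. x \<noteq> y \<longrightarrow> link_const E (x, y) (B k))"
    by (rule homogenize_on_later_blocks[OF AP cA disj nm a(1)])
  then obtain B1 where B1': "\<forall>i<n. B1 i \<subseteq> A i \<and> card (B1 i) = 2 ^ a1"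
    "\<forall>k<n. \<forall>i<k. \<forall>j<k. \<forall>x\<in>B1 i. \<forall>y\<in>B1 j. x \<noteq> y \<longrightarrow> link_const E (x, y) (B1 k)"
    by (elim exE conjE)
  note B1 = B1'(1)[rule_format, THEN conjunct1] B1'(1)[rule_format, THEN conjunct2]
  note later = B1'(2)[rule_format]
  \<comment> \<open>Reversing the order of the blocks turns the forward pass into the backward
    one.\<close>
  define r where "r i = n - 1 - i" for i
  have r: "r i < n" "r (r i) = i" if "i < n" for i using that by (auto simp: r_def)
  have r_less: "i < j \<Longrightarrow> j < n \<Longrightarrow> r j < r i" for i j by (auto simp: r_def)
  have "\<exists>B. (\<forall>i<n. B i \<subseteq> B1 (r i) \<and> card (B i) = 2 ^ a2) \<and>
    (\<forall>k<n. \<forall>i<k. \<forall>j<k. \<forall>x\<in>B i. \<forall>y\<in>B j. x \<noteq> y \<longrightarrow> link_const E (x, y) (B k))"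
  proof (rule homogenize_on_later_blocks[OF _ _ _ nm a(2)])
    show "B1 (r i) \<subseteq> P" if "i < n" for i using r(1)[OF that] B1(1) AP by blast
    show "2 ^ a1 \<le> card (B1 (r i))" if "i < n" for i using r(1)[OF that] B1(2) by simp
    show "B1 (r i) \<inter> B1 (r j) = {}" if "i < n" "j < n" "i \<noteq> j" for i j
      proof -
      have "r i \<noteq> r j" using r(2) that by metis
      then show ?thesis
        using disj[OF r(1)[OF that(1)] r(1)[OF that(2)]] B1(1)[OF r(1)] that by blast
    qed
  qed
  then obtain B2' where B2'': "\<forall>i<n. B2' i \<subseteq> B1 (r i) \<and> card (B2' i) = 2 ^ a2"
    "\<forall>k<n. \<forall>i<k. \<forall>j<k. \<forall>x\<in>B2' i. \<forall>y\<in>B2' j. x \<noteq> y \<longrightarrow> link_const E (x, y) (B2' k)"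
    by (elim exE conjE)
  note B2' = B2''(1)[rule_format, THEN conjunct1] B2''(1)[rule_format, THEN conjunct2] B2''(2)[rule_format]
  define B2 where "B2 i = B2' (r i)" for i
  have B2: "B2 i \<subseteq> B1 i" "card (B2 i) = 2 ^ a2" "B2 i \<subseteq> P" if "i < n" for i
    using B2'(1,2)[of "r i"] r that B1(1)[OF that] AP[OF that] by (auto simp: B2_def)
  have earlier: "link_const E (x, y) (B2 k)" if "k < i" "k < j" "i < n" "j < n" "x \<in> B2 i" "y \<in> B2 j" "x \<noteq> y" for i j k x y
    using B2'(3)[of "r k" "r i" "r j" x y] that r_less r by (auto simp: B2_def)
  have disj2: "x \<noteq> y" if "x \<in> B2 i" "y \<in> B2 j" "i < n" "j < n" "i \<noteq> j" for i j x y
    using disj[of i j] B1(1) B2(1) that by blast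
  have "B2 i \<noteq> {}" if "i < n" for i using B2(2)[OF that] by auto
  moreover define p where "p i = (SOME x. x \<in> B2 i)" for i
  ultimately have p: "p i \<in> B2 i" if "i < n" for i using that by (simp add: some_in_eq)
  \<comment> \<open>There are at most \<open>n * n\<close> pairs of representatives, so the cost of
    the last cut does not involve the block sizes.\<close>
  define W where "W j = {w \<in> (p ` {..<n}) \<times> (p ` {..<n}). fst w \<noteq> snd w \<and> fst w \<noteq> p j \<and> snd w \<noteq> p j}" for j
  have "\<exists>B'\<subseteq>B2 j. card (B2 j) \<le> 2 ^ (C * (2 * m + 1)) * card B' \<and> (\<forall>w\<in>W j. link_const E w B')" if j: "j < n" for j
  proof (rule cut_all)
    show "W j \<subseteq> P \<times> P" using p B2(3) by (fastforce simp: W_def)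
    show "B2 j \<subseteq> P" using B2 j by auto
    show "x \<noteq> y \<and> x \<notin> B2 j \<and> y \<notin> B2 j" if xy: "(x, y) \<in> W j" for x y
    proof -
      obtain i k where ik: "i < n" "k < n" "x = p i" "y = p k" "x \<noteq> y" "x \<noteq> p j" "y \<noteq> p j"
        using xy by (auto simp: W_def)
      then show ?thesis using disj2[of x i x j] disj2[of y k y j] p j by metis
    qed
    have "card (W j) \<le> card ((p ` {..<n}) \<times> (p ` {..<n}))" unfolding W_def by (intro card_mono) auto
    also have "\<dots> \<le> n * n"
      unfolding card_cartesian_product using card_image_le[of "{..<n}" p] by (intro mult_le_mono) auto
    also have "\<dots> \<le> 2 ^ m * 2 ^ m" using nm by (intro mult_le_mono)
    also have "\<dots> = 2 ^ (2 * m)" by (simp add: power_add mult_2)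
    also have "\<dots> < 2 ^ (2 * m + 1)" by simp
    finally show "card (W j) < 2 ^ (2 * m + 1)" .
  qed
  then obtain B where B: "\<And>j. j < n \<Longrightarrow> B j \<subseteq> B2 j"
      "\<And>j. j < n \<Longrightarrow> card (B2 j) \<le> 2 ^ (C * (2 * m + 1)) * card (B j)"
      "\<And>j w. j < n \<Longrightarrow> w \<in> W j \<Longrightarrow> link_const E w (B j)" by metis
  have size: "2 ^ a3 \<le> card (B j)" if "j < n" for j
  proof -
    have "(2::nat) ^ (a3 + C * (2 * m + 1)) \<le> 2 ^ a2" using a(3) by (intro power_increasing) auto
    then have "2 ^ (a3 + C * (2 * m + 1)) \<le> card (B2 j)" using B2(2)[OF that] by simp
    then show ?thesis using B(2)[OF that] by (rule power2_le_cancel)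
  qed
  have pair: "link_const E (x, y) (B k)" if "i < n" "k < n" "i \<noteq> k" "x \<in> B i" "y \<in> B i" "x \<noteq> y" for i k x y
  proof (cases "i < k")
    case True
    have "link_const E (x, y) (B1 k)" using later[OF \<open>k < n\<close> True True] that B(1) B2(1) by blast
    then show ?thesis using link_const_subset B(1) B2(1) \<open>k < n\<close> by blast
  next
    case False
    then have "link_const E (x, y) (B2 k)" using earlier[of k i i x y] that B(1) by auto
    then show ?thesis using link_const_subset B(1) \<open>k < n\<close> by blast
  qed
  \<comment> \<open>The outer points are replaced by representatives: \<open>z\<close> by the
    forward pass, then \<open>x\<close> by the backward pass.\<close>
  have mid: "{x, y, z} \<in> E \<longleftrightarrow> {p i, p k, y} \<in> E"
    if ijk: "i < j" "j < k" "k < n" and xyz: "x \<in> B2 i" "y \<in> B2 j" "z \<in> B2 k" for i j k x y z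
  proof -
    have "{x, y, z} \<in> E \<longleftrightarrow> {x, y, p k} \<in> E"
    proof (rule link_constD)
      have "x \<in> B1 i" "y \<in> B1 j" using B2(1)[of i] B2(1)[of j] ijk xyz by auto
      then show "link_const E (x, y) (B1 k)" using later[of k i j x y] ijk xyz disj2[of x i y j] by auto
      show "z \<in> B1 k" "p k \<in> B1 k" using B2(1) ijk xyz p by auto
    qed
    also have "\<dots> \<longleftrightarrow> {y, p k, x} \<in> E" by (simp add: insert_commute)
    also have "\<dots> \<longleftrightarrow> {y, p k, p i} \<in> E"
    proof (rule link_constD)
      show "link_const E (y, p k) (B2 i)" using earlier[of i j k y "p k"] ijk xyz p disj2[of y j "p k" k] by auto
      show "x \<in> B2 i" "p i \<in> B2 i" using ijk xyz p by auto
    qed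
    also have "\<dots> \<longleftrightarrow> {p i, p k, y} \<in> E" by (simp add: insert_commute)
    finally show ?thesis .
  qed
  have ordered: "{x, y, z} \<in> E \<longleftrightarrow> {x', y', z'} \<in> E"
    if ijk: "i < j" "j < k" "k < n" and xyz: "x \<in> B i" "x' \<in> B i" "y \<in> B j" "y' \<in> B j" "z \<in> B k" "z' \<in> B k"
    for i j k x x' y y' z z'
  proof -
    have "p i \<noteq> p k" "p i \<noteq> p j" "p k \<noteq> p j"
      using disj2[OF p p, of i k] disj2[OF p p, of i j] disj2[OF p p, of k j] ijk by auto
    then have "(p i, p k) \<in> W j" using ijk by (auto simp: W_def)
    moreover have "j < n" using ijk by simp
    ultimately have "link_const E (p i, p k) (B j)" using B(3) by blast
    then have "{p i, p k, y} \<in> E \<longleftrightarrow> {p i, p k, y'} \<in> E" by (rule link_constD[OF _ xyz(3,4)])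
    moreover have "x \<in> B2 i" "x' \<in> B2 i" "y \<in> B2 j" "y' \<in> B2 j" "z \<in> B2 k" "z' \<in> B2 k"
      using B(1) ijk xyz by (meson less_trans subsetD)+
    ultimately show ?thesis using mid[OF ijk] by blast
  qed
  have triple: "{x, y, z} \<in> E \<longleftrightarrow> {x', y', z'} \<in> E"
    if "i < n" "j < n" "k < n" and ne: "i \<noteq> j" "j \<noteq> k" "i \<noteq> k" and
      "x \<in> B i" "x' \<in> B i" "y \<in> B j" "y' \<in> B j" "z \<in> B k" "z' \<in> B k"
    for i j k x x' y y' z z'
  proof -
    consider "i < j \<and> j < k" | "i < k \<and> k < j" | "j < i \<and> i < k" | "j < k \<and> k < i"
      | "k < i \<and> i < j" | "k < j \<and> j < i" using ne by linarith
    then show ?thesis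
    proof cases
      case 1 then show ?thesis using ordered[of i j k x x' y y' z z'] that by blast
    next
      case 2 then show ?thesis using ordered[of i k j x x' z z' y y'] that by (simp add: insert_commute)
    next
      case 3 then show ?thesis using ordered[of j i k y y' x x' z z'] that by (simp add: insert_commute)
    next
      case 4 then show ?thesis using ordered[of j k i y y' z z' x x'] that by (simp add: insert_commute)
    next
      case 5 then show ?thesis using ordered[of k i j z z' x x' y y'] that by (simp add: insert_commute)
    next
      case 6 then show ?thesis using ordered[of k j i z z' y y' x x'] that by (simp add: insert_commute)
    qed
  qed
  have "\<forall>i<n. B i \<subseteq> A i \<and> 2 ^ a3 \<le> card (B i)" using B(1) B2(1) B1(1) size by blast
  then show ?thesis using pair triple by (intro exI[of _ B] conjI) blast+
qed

text \<open>All cuts together multiply the exponent by O(g) only, which is what permits many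
  iterations. Since \<open>m\<close> is below every block exponent, each homogenisation costs a
  factor of at most \<open>5 * C + 1\<close>; the larger base \<open>5 * C + 2\<close> absorbs the
  \<open>m\<close> added at the end.\<close>

lemma block_size_bound:
  assumes "1 \<le> g" "1 \<le> y" "m \<le> y"
    and a3: "a3 = 2 * y * (C * (g + 1) + 2)"
    and a2: "a2 = a3 + C * (2 * m + 1)"
    and a1: "a1 = a2 + C * (2 * (m + a2) + 1)"
    and a: "a = a1 + C * (2 * (m + a1) + 1)"
  shows "a + m \<le> 8 * C * (5 * C + 2) ^ 3 * g * y"
proof -
  have "y \<le> a3" unfolding a3 by simp
  have step: "b + C * (2 * (m + b) + 1) \<le> (5 * C + 1) * b" if "y \<le> b" for b
  proof -
    have "2 * (m + b) + 1 \<le> 5 * b" using assms(2,3) that by presburger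
    then have "C * (2 * (m + b) + 1) \<le> C * (5 * b)" by (rule mult_le_mono2)
    then show ?thesis by (simp add: algebra_simps)
  qed
  have "a2 \<le> a3 + C * (2 * (m + a3) + 1)" unfolding a2 by simp
  also have "\<dots> \<le> (5 * C + 1) * a3" by (rule step) fact
  also have "\<dots> \<le> (5 * C + 2) * a3" by simp
  finally have 2: "a2 \<le> (5 * C + 2) * a3" .
  have "y \<le> a2" using \<open>y \<le> a3\<close> a2 by simp
  then have "a1 \<le> (5 * C + 1) * a2" unfolding a1 by (rule step)
  also have "\<dots> \<le> (5 * C + 2) * a2" by simp
  finally have 1: "a1 \<le> (5 * C + 2) * a2" .
  have ya1: "y \<le> a1" using \<open>y \<le> a2\<close> a1 by simp
  then have "a + m \<le> (5 * C + 1) * a1 + a1" unfolding a using step[OF ya1] assms(3) by linarith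
  also have "\<dots> = (5 * C + 2) * a1" by simp
  also have "\<dots> \<le> (5 * C + 2) * ((5 * C + 2) * ((5 * C + 2) * a3))"
    using 1 2 by (intro mult_le_mono2) (meson le_trans mult_le_mono2)
  also have "\<dots> = (5 * C + 2) ^ 3 * a3" by (simp only: power3_eq_cube mult.assoc)
  also have "\<dots> \<le> (5 * C + 2) ^ 3 * (2 * y * (4 * C * g))"
  proof -
    have "C * 1 \<le> C * g" "1 * 1 \<le> C * g" using C_pos assms(1) by (intro mult_le_mono; simp)+
    moreover have "C * (g + 1) + 2 = C * g + C + 2" "4 * C * g = 4 * (C * g)" by simp_all
    ultimately have "C * (g + 1) + 2 \<le> 4 * C * g" by linarith
    then show ?thesis unfolding a3 by (intro mult_le_mono2)
  qed
  also have "\<dots> = 8 * C * (5 * C + 2) ^ 3 * g * y" by simp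
  finally show ?thesis .
qed

text \<open>Triples meeting three blocks are controlled by representatives, to which
  \<open>ramsey_poly_log\<close> applies. Triples meeting two blocks are excluded by making each
  block independent in the links of the other representatives; as links of pairs inside a block are
  constant on the other blocks, this carries over from a representative to its whole block.\<close>

lemma ex_transversal_free_blocks:
  assumes S: "S \<subseteq> P" and cf: "clique_free3 s S E"
    and lc: "\<And>p K. p \<in> P \<Longrightarrow> K \<subseteq> P - {p} \<Longrightarrow> link_clique E p K \<Longrightarrow> card K \<le> 2 ^ D"
    and sg: "s * 2 ^ g \<le> 2 ^ h" and g: "1 \<le> g" and y: "1 \<le> y" "D * 2 ^ g \<le> y"
    and my: "2 ^ (h * (C + 2)) * (C * (h * (C + 2) + 1) + 1) \<le> y"
    and big: "2 ^ (8 * C * (5 * C + 2) ^ 3 * g * y) \<le> card S"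
  shows "\<exists>T. (\<forall>i<2 ^ g. T i \<subseteq> S \<and> 2 ^ y \<le> card (T i)) \<and>
    (\<forall>i<2 ^ g. \<forall>j<2 ^ g. i \<noteq> j \<longrightarrow> T i \<inter> T j = {}) \<and>
    (\<forall>e\<in>E. e \<in> nsets (\<Union>i<(2::nat) ^ g. T i) 3 \<longrightarrow> (\<exists>i<2 ^ g. e \<subseteq> T i))"
proof -
  define m where "m = 2 ^ (h * (C + 2)) * (C * (h * (C + 2) + 1) + 1)"
  define a3 where "a3 = 2 * y * (C * (g + 1) + 2)"
  define a2 where "a2 = a3 + C * (2 * m + 1)"
  define a1 where "a1 = a2 + C * (2 * (m + a2) + 1)"
  define a where "a = a1 + C * (2 * (m + a1) + 1)"
  \<comment> \<open>So many blocks are prepared because the Ramsey step must still return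
    \<open>2 ^ g\<close> of their representatives.\<close>
  define n :: nat where "n = 2 ^ m"
  have "a + m \<le> 8 * C * (5 * C + 2) ^ 3 * g * y"
    using block_size_bound[OF g y(1) _ a3_def a2_def a1_def a_def] my by (simp add: m_def)
  then have "(2::nat) ^ (a + m) \<le> 2 ^ (8 * C * (5 * C + 2) ^ 3 * g * y)"
    by (intro power_increasing) auto
  also note big
  finally have "n * 2 ^ a \<le> card S" by (simp add: n_def power_add mult.commute)
  moreover have "finite S" using S finite_sub by blast
  ultimately obtain A where A: "\<forall>i<n. A i \<subseteq> S \<and> card (A i) = 2 ^ a" "\<forall>i<n. \<forall>j<n. i \<noteq> j \<longrightarrow> A i \<inter> A j = {}"
    using ex_disjoint_blocks[of S n "2 ^ a"] by blast
  have "\<exists>B. (\<forall>i<n. B i \<subseteq> A i \<and> 2 ^ a3 \<le> card (B i)) \<and>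
    (\<forall>i<n. \<forall>k<n. i \<noteq> k \<longrightarrow> (\<forall>x\<in>B i. \<forall>y\<in>B i. x \<noteq> y \<longrightarrow> link_const E (x, y) (B k))) \<and>
    (\<forall>i<n. \<forall>j<n. \<forall>k<n. i \<noteq> j \<longrightarrow> j \<noteq> k \<longrightarrow> i \<noteq> k \<longrightarrow>
       (\<forall>x\<in>B i. \<forall>x'\<in>B i. \<forall>y\<in>B j. \<forall>y'\<in>B j. \<forall>z\<in>B k. \<forall>z'\<in>B k. {x, y, z} \<in> E \<longleftrightarrow> {x', y', z'} \<in> E))"
  proof (rule homogeneous_blocks)
    show "A i \<subseteq> P" "2 ^ a \<le> card (A i)" if "i < n" for i using A(1) that S by auto
    show "A i \<inter> A j = {}" if "i < n" "j < n" "i \<noteq> j" for i j using A(2) that by blast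
    show "n \<le> 2 ^ m" by (simp add: n_def)
    show "a1 + C * (2 * (m + a1) + 1) \<le> a" "a2 + C * (2 * (m + a2) + 1) \<le> a1" "a3 + C * (2 * m + 1) \<le> a2"
      unfolding a_def a1_def a2_def by (rule le_refl)+
  qed
  then obtain B where B0: "\<forall>i<n. B i \<subseteq> A i \<and> 2 ^ a3 \<le> card (B i)"
    "\<forall>i<n. \<forall>k<n. i \<noteq> k \<longrightarrow> (\<forall>x\<in>B i. \<forall>y\<in>B i. x \<noteq> y \<longrightarrow> link_const E (x, y) (B k))"
    "\<forall>i<n. \<forall>j<n. \<forall>k<n. i \<noteq> j \<longrightarrow> j \<noteq> k \<longrightarrow> i \<noteq> k \<longrightarrow>
       (\<forall>x\<in>B i. \<forall>x'\<in>B i. \<forall>y\<in>B j. \<forall>y'\<in>B j. \<forall>z\<in>B k. \<forall>z'\<in>B k. {x, y, z} \<in> E \<longleftrightarrow> {x', y', z'} \<in> E)"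
    by (elim exE conjE)
  note homB = B0(2)[rule_format] and tripB = B0(3)[rule_format]
  have BS: "B i \<subseteq> S" "2 ^ a3 \<le> card (B i)" if "i < n" for i using B0(1) A(1) that by auto
  have disjB: "B i \<inter> B j = {}" if "i < n" "j < n" "i \<noteq> j" for i j
  proof -
    have "B i \<subseteq> A i" "B j \<subseteq> A j" "A i \<inter> A j = {}" using B0(1) A(2) that by auto
    then show ?thesis by blast
  qed
  have ne: "B i \<noteq> {}" if "i < n" for i
  proof
    assume "B i = {}"
    then show False using BS(2)[OF that] by simp
  qed
  define x where "x i = (SOME x. x \<in> B i)" for i
  have x: "x i \<in> B i" if "i < n" for i using ne[OF that] by (simp add: x_def some_in_eq)
  have inj: "inj_on x {..<n}"
    using x disjB by (intro inj_onI) (metis IntI emptyE lessThan_iff)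
  obtain I where I: "I \<subseteq> x ` {..<n}" "nsets I 3 \<inter> E = {}" "2 ^ h \<le> card I * s"
  proof -
    have sub: "x ` {..<n} \<subseteq> S" using x BS(1) by blast
    have c: "2 ^ m \<le> card (x ` {..<n})" using inj by (simp add: card_image n_def)
    have "\<exists>I\<subseteq>x ` {..<n}. nsets I 3 \<inter> E = {} \<and> 2 ^ h \<le> card I * s"
      by (rule ramsey_poly_log) (use sub c S clique_free3_subset[OF cf sub] in \<open>auto simp: m_def\<close>)
    then show thesis using that by blast
  qed
  define J where "J = {i\<in>{..<n}. x i \<in> I}"
  have "I = x ` J" using I(1) by (auto simp: J_def)
  moreover have "finite J" by (simp add: J_def)
  ultimately have "card I \<le> card J" using card_image_le by blast
  moreover have "2 ^ g \<le> card I"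
  proof -
    have "s * 2 ^ g \<le> s * card I" using order_trans[OF sg I(3)] by (simp add: mult.commute)
    moreover have "s \<noteq> 0" using I(3) by (cases "s = 0") auto
    ultimately show ?thesis by simp
  qed
  ultimately have "2 ^ g \<le> card J" by linarith
  then obtain J' where J': "J' \<subseteq> J" "card J' = 2 ^ g" by (meson obtain_subset_with_card_n)
  have "finite J'" by (rule ccontr) (use J'(2) in simp)
  then obtain f where f: "bij_betw f {..<(2::nat) ^ g} J'"
    using ex_bij_betw_nat_finite[of J'] J'(2) by (auto simp: atLeast0LessThan)
  have fJ: "f i < n" "x (f i) \<in> I" if "i < 2 ^ g" for i
  proof -
    have "f i \<in> J" using bij_betwE[OF f] that J'(1) by auto
    then show "f i < n" "x (f i) \<in> I" by (auto simp: J_def)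
  qed
  have f_inj: "f i \<noteq> f j" if "i < 2 ^ g" "j < 2 ^ g" "i \<noteq> j" for i j
    using f that by (auto simp: bij_betw_def inj_on_def)
  \<comment> \<open>The representatives of the other chosen blocks. They may be lost when the blocks
    shrink further, but they stay in \<open>B (f j)\<close>, where the links are constant.\<close>
  define Q where "Q i = (\<lambda>j. x (f j)) ` ({..<2 ^ g} - {i})" for i
  have "\<exists>T\<subseteq>B (f i). 2 ^ y \<le> card T \<and> (\<forall>p\<in>Q i. link_indep E p T)" if i: "i < 2 ^ g" for i
  proof -
    have cQ: "card (Q i) \<le> 2 ^ g"
    proof -
      have "card (Q i) \<le> card ({..<(2::nat) ^ g} - {i})" unfolding Q_def by (rule card_image_le) simp
      also have "\<dots> \<le> 2 ^ g" using card_mono[of "{..<(2::nat) ^ g}" "{..<2 ^ g} - {i}"] by simp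
      finally show ?thesis .
    qed
    have QB: "Q i \<inter> B (f i) = {}"
    proof -
      have "x (f j) \<notin> B (f i)" if "j < 2 ^ g" "j \<noteq> i" for j
        using x[OF fJ(1)[OF that(1)]] disjB[OF fJ(1)[OF that(1)] fJ(1)[OF i] f_inj[OF that(1) i that(2)]] by blast
      then show ?thesis by (auto simp: Q_def)
    qed
    have QP: "Q i \<subseteq> P"
    proof -
      have "x (f j) \<in> P" if "j < 2 ^ g" for j using x[OF fJ(1)[OF that]] BS(1)[OF fJ(1)[OF that]] S by blast
      then show ?thesis by (auto simp: Q_def)
    qed
    have BP: "B (f i) \<subseteq> P" using BS(1)[OF fJ(1)[OF i]] S by blast
    have "2 ^ (2 * y * (C * (g + 1) + 2)) \<le> card (B (f i))"
      using BS(2)[OF fJ(1)[OF i]] unfolding a3_def .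
    then obtain T0 where T0: "T0 \<subseteq> B (f i)" "cograph E (Q i) T0" "2 ^ (2 * y) \<le> card T0"
      using ex_cograph[OF QP BP QB cQ] by blast
    have "\<exists>I\<subseteq>T0. card T0 \<le> card I * (2 ^ D) ^ card (Q i) \<and> (\<forall>p\<in>Q i. link_indep E p I)"
    proof (rule cograph_link_indep_all[OF _ T0(2)])
      show "finite (Q i)" by (simp add: Q_def)
      show "card K \<le> 2 ^ D" if "p \<in> Q i" "K \<subseteq> T0" "link_clique E p K" for p K
      proof (rule lc[OF _ _ that(3)])
        show "p \<in> P" using QP that by blast
        show "K \<subseteq> P - {p}" using that T0(1) BP QB by blast
      qed
    qed
    then obtain T where T: "T \<subseteq> T0" "card T0 \<le> card T * (2 ^ D) ^ card (Q i)" "\<forall>p\<in>Q i. link_indep E p T"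
      by blast
    \<comment> \<open>Half of the exponent \<open>2 * y\<close> of the cograph pays for independence
      in all links, since \<open>D * 2 ^ g \<le> y\<close>.\<close>
    have "(2 ^ D) ^ card (Q i) = (2::nat) ^ (D * card (Q i))" by (simp add: power_mult)
    also have "\<dots> \<le> 2 ^ y"
      using order_trans[OF mult_le_mono2[OF cQ, of D] y(2)] by (intro power_increasing) auto
    finally have "card T * (2 ^ D) ^ card (Q i) \<le> card T * 2 ^ y" by (rule mult_le_mono2)
    then have "card T0 \<le> 2 ^ y * card T" using T(2) by (simp only: mult.commute)
    then have "2 ^ y \<le> card T" by (rule power2_le_cancel[OF T0(3)[unfolded mult_2]])
    then show ?thesis using T T0 by blast
  qed
  then obtain T where T: "\<And>i. i < 2 ^ g \<Longrightarrow> T i \<subseteq> B (f i)" "\<And>i. i < 2 ^ g \<Longrightarrow> 2 ^ y \<le> card (T i)"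
    "\<And>i p. i < 2 ^ g \<Longrightarrow> p \<in> Q i \<Longrightarrow> link_indep E p (T i)" by metis
  have two: "{u, v, w} \<notin> E" if "i < 2 ^ g" "k < 2 ^ g" "i \<noteq> k" "u \<in> T i" "v \<in> T i" "w \<in> T k" "u \<noteq> v" for i k u v w
  proof -
    have uvw: "u \<in> B (f i)" "v \<in> B (f i)" "w \<in> B (f k)" using T(1) that by auto
    have h: "link_const E (u, v) (B (f k))"
      by (rule homB[OF fJ(1)[OF that(1)] fJ(1)[OF that(2)] f_inj[OF that(1-3)] uvw(1,2) that(7)])
    have "x (f k) \<in> Q i" using that by (auto simp: Q_def)
    then have "{x (f k), u, v} \<notin> E" using T(3)[OF that(1)] that by (auto simp: link_indep_def)
    then show ?thesis using link_constD[OF h uvw(3) x[OF fJ(1)[OF that(2)]]] by (simp add: insert_commute)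
  qed
  have three: "{u, v, w} \<notin> E" if ijk: "i < 2 ^ g" "j < 2 ^ g" "k < 2 ^ g" "i \<noteq> j" "j \<noteq> k" "i \<noteq> k"
    and uvw: "u \<in> T i" "v \<in> T j" "w \<in> T k" for i j k u v w
  proof -
    have uvw': "u \<in> B (f i)" "v \<in> B (f j)" "w \<in> B (f k)" using T(1) ijk uvw by auto
    note fi = fJ(1)[OF ijk(1)] and fj = fJ(1)[OF ijk(2)] and fk = fJ(1)[OF ijk(3)]
    have neq: "f i \<noteq> f j" "f j \<noteq> f k" "f i \<noteq> f k" using f_inj ijk by auto
    have "{u, v, w} \<in> E \<longleftrightarrow> {x (f i), x (f j), x (f k)} \<in> E"
      by (rule tripB[OF fi fj fk neq uvw'(1) x[OF fi] uvw'(2) x[OF fj] uvw'(3) x[OF fk]])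
    moreover have "x (f i) \<noteq> x (f j)" "x (f j) \<noteq> x (f k)" "x (f i) \<noteq> x (f k)"
      using inj neq fi fj fk by (auto simp: inj_on_def)
    then have "{x (f i), x (f j), x (f k)} \<in> nsets I 3"
      unfolding nsets_3_iff using fJ(2) ijk by blast
    ultimately show ?thesis using I(2) by blast
  qed
  show ?thesis
  proof (intro exI[of _ T] conjI allI impI ballI)
    fix i assume i: "i < (2::nat) ^ g"
    show "T i \<subseteq> S" using T(1)[OF i] BS(1)[OF fJ(1)[OF i]] by blast
    show "2 ^ y \<le> card (T i)" using T(2)[OF i] .
  next
    fix i j assume ij: "i < (2::nat) ^ g" "j < 2 ^ g" "i \<noteq> j"
    show "T i \<inter> T j = {}"
      using T(1)[OF ij(1)] T(1)[OF ij(2)] disjB[OF fJ(1)[OF ij(1)] fJ(1)[OF ij(2)] f_inj[OF ij]] by blast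
  next
    fix e assume e: "e \<in> E" "e \<in> nsets (\<Union>i<(2::nat) ^ g. T i) 3"
    then obtain u v w where uvw: "u \<in> (\<Union>i<(2::nat) ^ g. T i)" "v \<in> (\<Union>i<(2::nat) ^ g. T i)"
        "w \<in> (\<Union>i<(2::nat) ^ g. T i)" "e = {u, v, w}" "u \<noteq> v" "v \<noteq> w" "u \<noteq> w"
      unfolding nsets_3_iff by blast
    then obtain i j k where ijk: "i < 2 ^ g" "j < 2 ^ g" "k < 2 ^ g" "u \<in> T i" "v \<in> T j" "w \<in> T k" by blast
    have perm: "{u, v, w} = {u, w, v}" "{u, v, w} = {v, w, u}" by auto
    have "i = j \<and> j = k"
    proof (rule ccontr)
      assume "\<not> (i = j \<and> j = k)"
      then consider "i = j" "i \<noteq> k" | "i = k" "i \<noteq> j" | "j = k" "i \<noteq> j" | "i \<noteq> j" "j \<noteq> k" "i \<noteq> k" by blast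
      then show False
      proof cases
        case 1 then show False using two[of i k u v w] ijk uvw e by simp
      next
        case 2 then show False using two[of i j u w v] ijk uvw e perm(1) by simp
      next
        case 3 then show False using two[of j i v w u] ijk uvw e perm(2) by simp
      next
        case 4 then show False using three[of i j k u v w] ijk uvw e by simp
      qed
    qed
    then show "\<exists>i<2 ^ g. e \<subseteq> T i" using ijk uvw(4) by blast
  qed
qed

text \<open>Edges within the union of the blocks lie in single blocks, so independent sets found in
  all blocks unite. One level gains a factor \<open>2 ^ g\<close> in size and divides the exponent
  of the ambient set by a constant multiple of \<open>g\<close>.\<close>

lemma ex_independent_iterate:
  assumes S: "S \<subseteq> P" and cf: "clique_free3 s P E"
    and lc: "\<And>p K. p \<in> P \<Longrightarrow> K \<subseteq> P - {p} \<Longrightarrow> link_clique E p K \<Longrightarrow> card K \<le> 2 ^ D"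
    and sg: "s * 2 ^ g \<le> 2 ^ h" and g: "1 \<le> g" and y: "1 \<le> y" "D * 2 ^ g \<le> y"
    and my: "2 ^ (h * (C + 2)) * (C * (h * (C + 2) + 1) + 1) \<le> y"
    and big: "2 ^ ((8 * C * (5 * C + 2) ^ 3 * g) ^ k * y) \<le> card S"
  shows "\<exists>I\<subseteq>S. nsets I 3 \<inter> E = {} \<and> 2 ^ (g * k) \<le> card I"
  using S big
proof (induction k arbitrary: S)
  case 0
  then obtain x where "x \<in> S" by fastforce
  then show ?case by (intro exI[of _ "{x}"]) (auto simp: nsets_3_iff)
next
  case (Suc k)
  \<comment> \<open>The exponent left for the blocks. It is never below \<open>y\<close>, so the
    conditions on \<open>D\<close> and \<open>h\<close> hold at every level.\<close>
  define y' where "y' = (8 * C * (5 * C + 2) ^ 3 * g) ^ k * y"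
  have "1 \<le> (8 * C * (5 * C + 2) ^ 3 * g) ^ k" using C_pos g by simp
  then have yy: "y \<le> y'" by (simp add: y'_def)
  have big': "2 ^ (8 * C * (5 * C + 2) ^ 3 * g * y') \<le> card S"
    using Suc.prems(2) by (simp add: y'_def mult.assoc)
  have y': "1 \<le> y'" "D * 2 ^ g \<le> y'" "2 ^ (h * (C + 2)) * (C * (h * (C + 2) + 1) + 1) \<le> y'"
    using yy y my by linarith+
  have "\<exists>T. (\<forall>i<2 ^ g. T i \<subseteq> S \<and> 2 ^ y' \<le> card (T i)) \<and>
    (\<forall>i<2 ^ g. \<forall>j<2 ^ g. i \<noteq> j \<longrightarrow> T i \<inter> T j = {}) \<and>
    (\<forall>e\<in>E. e \<in> nsets (\<Union>i<(2::nat) ^ g. T i) 3 \<longrightarrow> (\<exists>i<2 ^ g. e \<subseteq> T i))"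
    by (rule ex_transversal_free_blocks[OF Suc.prems(1) clique_free3_subset[OF cf Suc.prems(1)] lc sg g y' big'])
  then obtain T where T: "\<forall>i<2 ^ g. T i \<subseteq> S \<and> 2 ^ y' \<le> card (T i)"
    "\<forall>i<2 ^ g. \<forall>j<2 ^ g. i \<noteq> j \<longrightarrow> T i \<inter> T j = {}"
    "\<forall>e\<in>E. e \<in> nsets (\<Union>i<(2::nat) ^ g. T i) 3 \<longrightarrow> (\<exists>i<2 ^ g. e \<subseteq> T i)"
    by (elim exE conjE)
  have "\<exists>I\<subseteq>T i. nsets I 3 \<inter> E = {} \<and> 2 ^ (g * k) \<le> card I" if "i < 2 ^ g" for i
    using Suc.IH[of "T i"] T(1) that Suc.prems(1) unfolding y'_def by blast
  then obtain I where I: "\<And>i. i < 2 ^ g \<Longrightarrow> I i \<subseteq> T i" "\<And>i. i < 2 ^ g \<Longrightarrow> nsets (I i) 3 \<inter> E = {}"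
    "\<And>i. i < 2 ^ g \<Longrightarrow> 2 ^ (g * k) \<le> card (I i)" by metis
  define U where "U = (\<Union>i<(2::nat) ^ g. I i)"
  have disj: "I i \<inter> I j = {}" if "i < 2 ^ g" "j < 2 ^ g" "i \<noteq> j" for i j
    using I(1)[OF that(1)] I(1)[OF that(2)] T(2) that by blast
  have US: "U \<subseteq> S" using I(1) T(1) by (fastforce simp: U_def)
  have "finite (I i)" if "i < 2 ^ g" for i
    using I(1)[OF that] T(1) that Suc.prems(1) finite_sub by (meson order_trans)
  then have "card U = (\<Sum>i<(2::nat) ^ g. card (I i))"
    unfolding U_def using disj by (intro card_UN_disjoint) auto
  moreover have "(\<Sum>i<(2::nat) ^ g. 2 ^ (g * k)) \<le> (\<Sum>i<(2::nat) ^ g. card (I i))"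
    using I(3) by (intro sum_mono) auto
  ultimately have "2 ^ (g * Suc k) \<le> card U" by (simp add: power_add)
  moreover have "nsets U 3 \<inter> E = {}"
  proof (rule equals0I)
    fix e assume e: "e \<in> nsets U 3 \<inter> E"
    have "U \<subseteq> (\<Union>i<(2::nat) ^ g. T i)" using I(1) by (fastforce simp: U_def)
    then have "e \<in> nsets (\<Union>i<(2::nat) ^ g. T i) 3" using e by (auto simp: nsets_def)
    then obtain i where i: "i < 2 ^ g" "e \<subseteq> T i" using T(3) e by blast
    have "e \<subseteq> I i"
    proof
      fix x assume x: "x \<in> e"
      then obtain j where j: "j < 2 ^ g" "x \<in> I j" using e by (auto simp: nsets_def U_def)
      have "j = i"
      proof (rule ccontr)
        assume "j \<noteq> i"
        then have "T j \<inter> T i = {}" using T(2) i(1) j(1) by blast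
        then show False using I(1)[OF j(1)] j(2) x i(2) by blast
      qed
      then show "x \<in> I i" using j by simp
    qed
    then have "e \<in> nsets (I i) 3 \<inter> E" using e by (auto simp: nsets_def)
    then show False using I(2)[OF i(1)] by simp
  qed
  ultimately show ?case using US by blast
qed

section \<open>The recursion\<close>

text \<open>A single parameter \<open>g\<close> now controls the rest: \<open>h = 2 * g\<close>,
  \<open>D = 2 ^ ((5 * C + 8) * g)\<close> and \<open>y = 2 ^ ((5 * C + 9) * g)\<close>. Then
  \<open>y\<close> equals \<open>D * 2 ^ g\<close> and also dominates the Ramsey cost.\<close>

lemma ex_independent:
  assumes cf: "clique_free3 s P E"
    and lc: "\<And>p K. p \<in> P \<Longrightarrow> K \<subseteq> P - {p} \<Longrightarrow> link_clique E p K \<Longrightarrow> card K \<le> 2 ^ (2 ^ ((5 * C + 8) * g))"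
    and s: "s \<le> 2 ^ g" and g: "1 \<le> g"
    and big: "2 ^ ((8 * C * (5 * C + 2) ^ 3 * g) ^ k * 2 ^ ((5 * C + 9) * g)) \<le> card P"
  shows "\<exists>I\<subseteq>P. nsets I 3 \<inter> E = {} \<and> 2 ^ (g * k) \<le> card I"
proof (rule ex_independent_iterate[OF _ cf lc _ g _ _ _ big])
  show "s * 2 ^ g \<le> 2 ^ (2 * g)" using s by (simp add: mult_2 power_add)
  show "2 ^ ((5 * C + 8) * g) * 2 ^ g \<le> (2::nat) ^ ((5 * C + 9) * g)"
    by (simp add: power_add[symmetric] algebra_simps)
  show "2 ^ (2 * g * (C + 2)) * (C * (2 * g * (C + 2) + 1) + 1) \<le> (2::nat) ^ ((5 * C + 9) * g)"
  proof -
    define w where "w = 2 * g * (C + 2)"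
    have less: "n + 1 \<le> 2 ^ n" for n :: nat using less_exp[of n] by linarith
    have "C * (w + 1) + 1 \<le> (C + 1) * (w + 1)" by simp
    also have "\<dots> \<le> 2 ^ C * 2 ^ w" by (intro mult_le_mono less)
    finally have "2 ^ w * (C * (w + 1) + 1) \<le> 2 ^ w * (2 ^ C * 2 ^ w)" by (rule mult_le_mono2)
    also have "\<dots> = 2 ^ (2 * w + C)" by (simp add: power_add mult_2)
    also have "\<dots> \<le> 2 ^ ((5 * C + 9) * g)"
    proof (intro power_increasing)
      have "C * 1 \<le> C * g" using g by (intro mult_le_mono2)
      moreover have "2 * w = 4 * (C * g) + 8 * g" "(5 * C + 9) * g = 5 * (C * g) + 9 * g"
        by (simp_all add: w_def algebra_simps)
      ultimately show "2 * w + C \<le> (5 * C + 9) * g" by linarith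
    qed simp
    finally show ?thesis unfolding w_def .
  qed
qed simp_all

text \<open>The constant is inherited unchanged, so the induction on \<open>s\<close> can move to
  subsets.\<close>

lemma cutting_subset:
  assumes "P' \<subseteq> P"
  shows "cutting P' E C"
proof
  show "finite P'" using assms by (rule finite_sub)
  show "1 \<le> C" by (rule C_pos)
  show "\<exists>B'\<subseteq>B. card B \<le> 2 ^ (C * b) * card B' \<and> 2 ^ b * card {w \<in> W. \<not> link_const E w B'} \<le> card W"
    if "W \<subseteq> P' \<times> P'" "B \<subseteq> P'" "\<And>x y. (x, y) \<in> W \<Longrightarrow> x \<noteq> y \<and> x \<notin> B \<and> y \<notin> B" for W B b
    using that assms by (intro cut) auto
qed

end

text \<open>Adding \<open>p\<close> to a clique inside \<open>K\<close> gives a clique with one more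
  point; this is how \<open>s\<close> decreases.\<close>

lemma clique_free3_link_clique:
  assumes cf: "clique_free3 (Suc s) P E" and p: "p \<in> P" and K: "K \<subseteq> P - {p}" "link_clique E p K"
  shows "clique_free3 s K E"
  unfolding clique_free3_def
proof
  fix S assume S: "S \<in> nsets K s"
  then have "insert p S \<in> nsets P (Suc s)" using p K by (auto simp: nsets_def card_insert_if)
  then obtain T where T: "T \<in> nsets (insert p S) 3" "T \<notin> E" using cf by (auto simp: clique_free3_def)
  have "p \<notin> T"
  proof
    assume "p \<in> T"
    then obtain x y where "x \<in> S" "y \<in> S" "x \<noteq> y" "T = {p, x, y}"
      using T(1) unfolding nsets_3_iff by (auto simp: insert_commute)
    then show False using T(2) K S by (auto simp: link_clique_def nsets_def)
  qed
  then have "T \<in> nsets S 3" using T(1) by (auto simp: nsets_def)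
  then show "\<exists>T\<in>nsets S 3. T \<notin> E" using T(2) by blast
qed

section \<open>Choice of parameters and induction on the clique size\<close>

lemma eight_log_le:
  assumes "64 \<le> (x::real)"
  shows "8 * log 2 x \<le> x"
proof -
  have ln2: "1 / 2 \<le> ln (2::real)" using ln2_ge_two_thirds by linarith
  \<comment> \<open>The tangent bound for the logarithm at 64, where the binary logarithm is 6, is
    sharp enough.\<close>
  have "ln (x / 64) \<le> x / 64 - 1" using assms by (intro ln_le_minus_one) simp
  then have "log 2 (x / 64) \<le> (x / 64 - 1) / ln 2" unfolding log_def by (intro divide_right_mono) auto
  also have "\<dots> \<le> (x / 64 - 1) / (1 / 2)" using ln2 assms by (intro divide_left_mono) auto
  finally have "log 2 (x / 64) \<le> x / 32 - 2" by simp
  moreover have "log 2 (x / 64) = log 2 x - 6"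
    using assms log_pow_cancel[of 2 6] by (simp add: log_divide)
  ultimately show ?thesis using assms by linarith
qed

definition indep_exponent :: "real \<Rightarrow> nat \<Rightarrow> nat \<Rightarrow> real" where
  "indep_exponent c s n = (log 2 (log 2 (real n)))\<^sup>2 / (c ^ s * log 2 (log 2 (log 2 (real n))))"

text \<open>The constant \<open>\<kappa>\<close> has a summand for each demand on \<open>L\<close>:
  \<open>8 * (5 * C + 9)\<close> makes \<open>g\<close> large, and
  \<open>8 * C * (5 * C + 2) ^ 3\<close> bounds the constant lost in one level of the iteration. It
  is squared in \<open>c\<close> because the exponent to be reached is quadratic in
  \<open>L\<close>.\<close>

lemma ex_independent_step:
  fixes C :: nat and c \<kappa> :: real
  defines "\<kappa> \<equiv> 8 * (5 * C + 9) + 8 * C * (5 * C + 2) ^ 3"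
  defines "c \<equiv> \<kappa>\<^sup>2"
  assumes cut: "cutting P E C" and cf: "clique_free3 (Suc s) P E" and N: "16 < card P"
    and IH: "\<And>Q. cutting Q E C \<Longrightarrow> clique_free3 s Q E \<Longrightarrow> 16 < card Q \<Longrightarrow>
      \<exists>P'\<subseteq>Q. nsets P' 3 \<inter> E = {} \<and> 2 powr indep_exponent c s (card Q) \<le> real (card P')"
  shows "\<exists>P'\<subseteq>P. nsets P' 3 \<inter> E = {} \<and> 2 powr indep_exponent c (Suc s) (card P) \<le> real (card P')"
proof -
  interpret cutting P E C by (rule cut)
  define M where "M = log 2 (real (card P))"
  define L where "L = log 2 M"
  define \<mu> where "\<mu> = log 2 L"
  have "log 2 16 < M" unfolding M_def using N by (subst log_less_cancel_iff) auto
  moreover have log16: "log 2 16 = (4::real)" using log_pow_cancel[of 2 4] by simp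
  ultimately have M: "4 < M" by simp
  then have "log 2 4 < L" unfolding L_def by (subst log_less_cancel_iff) auto
  moreover have "log 2 4 = (2::real)" using log_pow_cancel[of 2 2] by simp
  ultimately have L2: "2 < L" by simp
  then have "log 2 2 < \<mu>" unfolding \<mu>_def by (subst log_less_cancel_iff) auto
  then have \<mu>: "1 < \<mu>" by simp
  have expo: "indep_exponent c (Suc s) (card P) = L\<^sup>2 / (c ^ Suc s * \<mu>)"
    by (simp add: indep_exponent_def \<mu>_def L_def M_def)
  have \<kappa>: "72 \<le> \<kappa>" by (simp add: \<kappa>_def)
  have c_pos: "0 < c" using \<kappa> by (simp add: c_def)
  show ?thesis
  proof (cases "L\<^sup>2 \<le> c ^ Suc s * \<mu>")
    case True
    then have "indep_exponent c (Suc s) (card P) \<le> 1" unfolding expo using c_pos \<mu> by (simp add: divide_le_eq)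
    then have le2: "2 powr indep_exponent c (Suc s) (card P) \<le> 2"
      using powr_mono[of "indep_exponent c (Suc s) (card P)" 1 2] by simp
    \<comment> \<open>The required size is at most 2 here, and two points span no triple.\<close>
    obtain P' where P': "P' \<subseteq> P" "card P' = 2" "finite P'"
      using obtain_subset_with_card_n[of 2 P] N by auto
    have "nsets P' 3 = {}"
    proof (rule equals0I)
      fix e assume "e \<in> nsets P' 3"
      then have "card e = 3" "card e \<le> card P'" using card_mono[OF P'(3), of e] by (auto simp: nsets_def)
      then show False using P' by simp
    qed
    then show ?thesis using P' le2 by (intro exI[of _ P']) auto
  next
    case False
    have "c ^ Suc s * 1 \<le> c ^ Suc s * \<mu>" using c_pos \<mu> by (intro mult_left_mono) auto
    moreover have "(\<kappa> ^ Suc s)\<^sup>2 = c ^ Suc s" unfolding c_def by (simp only: power_mult[symmetric] mult.commute)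
    ultimately have "(\<kappa> ^ Suc s)\<^sup>2 < L\<^sup>2" using False by linarith
    then have L\<kappa>s: "\<kappa> ^ Suc s < L" by (rule power_less_imp_less_base) (use L2 in simp)
    have "\<kappa> ^ 1 \<le> \<kappa> ^ Suc s" using \<kappa> by (intro power_increasing) auto
    then have L\<kappa>: "\<kappa> < L" using L\<kappa>s by simp
    define \<gamma> where "\<gamma> = real (5 * C + 8)"
    have \<gamma>: "8 \<le> \<gamma>" by (simp add: \<gamma>_def)
    have \<kappa>\<gamma>: "8 * (\<gamma> + 1) \<le> \<kappa>" by (simp add: \<kappa>_def \<gamma>_def)
    \<comment> \<open>Chosen such that \<open>2 ^ ((5 * C + 9) * g)\<close> is at most the square
      root of \<open>M\<close>.\<close>
    define g where "g = nat \<lfloor>L / (2 * (\<gamma> + 1))\<rfloor>"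
    \<comment> \<open>The loss per level is at most \<open>L * L = 2 powr (2 * \<mu>)\<close>, so
      \<open>k\<close> levels cost at most the other square root of \<open>M\<close>.\<close>
    define k where "k = nat \<lfloor>L / (4 * \<mu>)\<rfloor>"
    have g_le: "real g \<le> L / (2 * (\<gamma> + 1))" unfolding g_def using L2 \<gamma> by (simp add: of_nat_nat)
    have k_le: "real k \<le> L / (4 * \<mu>)" unfolding k_def using L2 \<mu> by (simp add: of_nat_nat)
    have g_ge: "L / (4 * (\<gamma> + 1)) \<le> real g"
    proof -
      \<comment> \<open>Rounding down loses at most half, because the integer part of
        \<open>2 * q\<close> is at least \<open>q\<close> once \<open>1 \<le> q\<close>.\<close>
      define q where "q = L / (4 * (\<gamma> + 1))"
      have "L / (2 * (\<gamma> + 1)) = 2 * q" using \<gamma> by (simp add: q_def field_simps)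
      then have "g = nat \<lfloor>2 * q\<rfloor>" by (simp add: g_def)
      moreover have "1 \<le> q" using L\<kappa> \<kappa>\<gamma> \<gamma> by (simp add: q_def le_divide_eq)
      ultimately have "q \<le> real g" by linarith
      then show ?thesis by (simp add: q_def)
    qed
    have k_ge: "L / (8 * \<mu>) \<le> real k"
    proof -
      define q where "q = L / (8 * \<mu>)"
      have "L / (4 * \<mu>) = 2 * q" using \<mu> by (simp add: q_def field_simps)
      then have "k = nat \<lfloor>2 * q\<rfloor>" by (simp add: k_def)
      moreover have "8 * \<mu> \<le> L" unfolding \<mu>_def using L\<kappa> \<kappa> by (intro eight_log_le) auto
      then have "1 \<le> q" using \<mu> by (simp add: q_def le_divide_eq)
      ultimately have "q \<le> real k" by linarith
      then show ?thesis by (simp add: q_def)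
    qed
    \<comment> \<open>Since \<open>L\<close> exceeds \<open>\<kappa> ^ Suc s\<close>,
      \<open>g\<close> grows exponentially with \<open>s\<close>, which gives
      \<open>Suc s \<le> 2 ^ g\<close> with room to spare.\<close>
    have "2 * 2 ^ s \<le> real g"
    proof -
      have "8 * (\<gamma> + 1) * 2 ^ s \<le> \<kappa> * \<kappa> ^ s" using \<kappa> \<kappa>\<gamma> \<gamma> by (intro mult_mono power_mono) auto
      also have "\<dots> \<le> L" using L\<kappa>s by simp
      finally have "2 * 2 ^ s \<le> L / (4 * (\<gamma> + 1))" using \<gamma> by (simp add: le_divide_eq algebra_simps)
      then show ?thesis using g_ge by linarith
    qed
    then have "real (2 * 2 ^ s) \<le> real g" by simp
    then have g_s: "2 * 2 ^ s \<le> g" by (simp only: of_nat_le_iff)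
    have "(1::nat) \<le> 2 ^ s" by simp
    then have g1: "1 \<le> g" using g_s by linarith
    have "Suc s \<le> 2 ^ s" using less_exp[of s] by linarith
    then have "Suc s \<le> g" using g_s by linarith
    then have s_le: "Suc s \<le> 2 ^ g" using less_exp[of g] by linarith
    define D :: nat where "D = 2 ^ ((5 * C + 8) * g)"
    show ?thesis
    \<comment> \<open>Either a link contains a clique so large that its double logarithm is
      comparable to \<open>L\<close>, and the hypothesis for \<open>s\<close> applies to it, or all
      link cliques are small enough for the iteration.\<close>
    proof (cases "\<exists>p\<in>P. \<exists>K\<subseteq>P - {p}. link_clique E p K \<and> 2 ^ D < card K")
      case True
      then obtain p K where pK: "p \<in> P" "K \<subseteq> P - {p}" "link_clique E p K" "2 ^ D < card K" by blast
      then obtain Q where Q: "Q \<subseteq> K" "card Q = 2 ^ D" "finite Q"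
        by (meson less_imp_le obtain_subset_with_card_n)
      have QP: "Q \<subseteq> P" using Q pK by blast
      have cfQ: "clique_free3 s Q E"
        using clique_free3_subset[OF clique_free3_link_clique[OF cf pK(1-3)] Q(1)] .
      define u where "u = \<gamma> * real g"
      have u: "log 2 (log 2 (real (card Q))) = u"
      proof -
        have "log 2 (real (card Q)) = real D" using Q(2) by (simp add: log_nat_power)
        also have "\<dots> = 2 ^ ((5 * C + 8) * g)" by (simp add: D_def)
        finally show ?thesis by (simp add: log_nat_power u_def \<gamma>_def)
      qed
      \<comment> \<open>The induction hypothesis requires more than 16 points.\<close>
      have "(8::nat) * 1 \<le> (5 * C + 8) * g" using g1 by (intro mult_le_mono) auto
      then have "(2::nat) ^ 8 \<le> D" unfolding D_def by (intro power_increasing) auto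
      then have "(2::nat) ^ 8 \<le> 2 ^ D" using less_exp[of D] by linarith
      then have "16 < card Q" using Q(2) by simp
      then obtain P' where P': "P' \<subseteq> Q" "nsets P' 3 \<inter> E = {}"
          "2 powr indep_exponent c s (card Q) \<le> real (card P')"
        using IH[OF cutting_subset[OF QP] cfQ] by blast
      have uL: "u \<le> L"
      proof -
        have "u \<le> \<gamma> * (L / (2 * (\<gamma> + 1)))" unfolding u_def using g_le \<gamma> by (intro mult_left_mono) auto
        also have "\<dots> \<le> L" using \<gamma> L2 by (simp add: divide_le_eq algebra_simps)
        finally show ?thesis .
      qed
      \<comment> \<open>Passing to the link costs a factor of at most 64 in the squared double
        logarithm, which the additional factor \<open>c\<close> in the denominator covers.\<close>
      have Lu: "L / 8 \<le> u"
      proof -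
        have "L / 8 \<le> \<gamma> * (L / (4 * (\<gamma> + 1)))" using \<gamma> L2 by (simp add: field_simps)
        also have "\<dots> \<le> u" unfolding u_def using g_ge \<gamma> by (intro mult_left_mono) auto
        finally show ?thesis .
      qed
      have u1: "8 < u" using Lu L\<kappa> \<kappa> by linarith
      have logu: "0 < log 2 u" "log 2 u \<le> \<mu>" unfolding \<mu>_def using u1 uL by auto
      have "L\<^sup>2 / (c ^ Suc s * \<mu>) \<le> u\<^sup>2 / (c ^ s * log 2 u)"
      proof -
        have "L\<^sup>2 \<le> (8 * u)\<^sup>2" using Lu L2 by (intro power_mono) auto
        also have "\<dots> \<le> c * u\<^sup>2"
        proof -
          have "8\<^sup>2 \<le> \<kappa>\<^sup>2" using \<kappa> by (intro power_mono) auto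
          then show ?thesis unfolding c_def power_mult_distrib by (intro mult_right_mono) auto
        qed
        finally have "L\<^sup>2 / (c ^ Suc s * \<mu>) \<le> c * u\<^sup>2 / (c ^ Suc s * \<mu>)"
          using c_pos \<mu> by (intro divide_right_mono) auto
        also have "\<dots> = u\<^sup>2 / (c ^ s * \<mu>)" using c_pos by simp
        also have "\<dots> \<le> u\<^sup>2 / (c ^ s * log 2 u)"
          using c_pos logu \<mu> by (intro divide_left_mono mult_left_mono) auto
        finally show ?thesis .
      qed
      also have "\<dots> = indep_exponent c s (card Q)" unfolding indep_exponent_def u ..
      finally have "indep_exponent c (Suc s) (card P) \<le> indep_exponent c s (card Q)" unfolding expo .
      then have "2 powr indep_exponent c (Suc s) (card P) \<le> 2 powr indep_exponent c s (card Q)"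
        by (intro powr_mono) auto
      then have "2 powr indep_exponent c (Suc s) (card P) \<le> real (card P')" using P'(3) by (rule order_trans)
      then show ?thesis using P'(1,2) QP by blast
    next
      case False
      then have lc: "card K \<le> 2 ^ (2 ^ ((5 * C + 8) * g))" if "p \<in> P" "K \<subseteq> P - {p}" "link_clique E p K" for p K
        using that unfolding D_def by (meson not_le)
      define \<Lambda> where "\<Lambda> = 8 * C * (5 * C + 2) ^ 3 * g"
      have L_pow: "L = 2 powr \<mu>" "M = 2 powr L" "real (card P) = 2 powr M"
        using L2 M N by (simp_all add: \<mu>_def L_def M_def)
      \<comment> \<open>One factor \<open>L\<close> bounds the constant by way of
        \<open>\<kappa>\<close>, the other bounds \<open>g\<close>.\<close>
      have "real \<Lambda> \<le> L * L"
      proof -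
        have "real (8 * C * (5 * C + 2) ^ 3) \<le> L" using L\<kappa> by (simp add: \<kappa>_def)
        moreover have "L / (2 * (\<gamma> + 1)) \<le> L" using \<gamma> L2 by (simp add: divide_le_eq)
        then have "real g \<le> L" using g_le by linarith
        ultimately have "real (8 * C * (5 * C + 2) ^ 3) * real g \<le> L * L"
          using L2 by (intro mult_mono) auto
        then show ?thesis by (simp add: \<Lambda>_def)
      qed
      then have "real \<Lambda> ^ k \<le> (L * L) ^ k" by (intro power_mono) auto
      also have "L * L = 2 powr (2 * \<mu>)" unfolding L_pow(1) by (simp add: powr_add[symmetric])
      also have "(2 powr (2 * \<mu>)) ^ k = 2 powr (2 * \<mu> * real k)" by (simp add: powr_powr[symmetric] powr_realpow)
      also have "\<dots> \<le> 2 powr (L / 2)"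
        using k_le \<mu> by (intro powr_mono) (auto simp: le_divide_eq algebra_simps)
      finally have 1: "real \<Lambda> ^ k \<le> 2 powr (L / 2)" .
      have "real (2 ^ ((5 * C + 9) * g)) = 2 powr ((\<gamma> + 1) * real g)"
        by (simp add: \<gamma>_def powr_realpow[symmetric] algebra_simps)
      also have "\<dots> \<le> 2 powr (L / 2)"
        using g_le \<gamma> by (intro powr_mono) (auto simp: le_divide_eq algebra_simps)
      finally have 2: "real (2 ^ ((5 * C + 9) * g)) \<le> 2 powr (L / 2)" .
      have "real (\<Lambda> ^ k * 2 ^ ((5 * C + 9) * g)) = real \<Lambda> ^ k * real (2 ^ ((5 * C + 9) * g))" by simp
      also have "\<dots> \<le> 2 powr (L / 2) * 2 powr (L / 2)" by (intro mult_mono 1 2) auto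
      also have "\<dots> = M" unfolding powr_add[symmetric] L_pow(2) by simp
      finally have "2 powr real (\<Lambda> ^ k * 2 ^ ((5 * C + 9) * g)) \<le> real (card P)"
        unfolding L_pow(3) by (intro powr_mono) auto
      then have "real (2 ^ (\<Lambda> ^ k * 2 ^ ((5 * C + 9) * g))) \<le> real (card P)"
        by (subst (asm) powr_realpow) auto
      then have big: "2 ^ (\<Lambda> ^ k * 2 ^ ((5 * C + 9) * g)) \<le> card P" by (simp only: of_nat_le_iff)
      have "\<exists>I\<subseteq>P. nsets I 3 \<inter> E = {} \<and> 2 ^ (g * k) \<le> card I"
        by (rule ex_independent[OF cf _ s_le g1 big[unfolded \<Lambda>_def]]) (rule lc)
      then obtain I where I: "I \<subseteq> P" "nsets I 3 \<inter> E = {}" "2 ^ (g * k) \<le> card I" by blast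
      have "L\<^sup>2 / (c ^ Suc s * \<mu>) \<le> real g * real k"
      proof -
        \<comment> \<open>The number 32 is the product of the factors 4 and 8 in the lower bounds
          for \<open>g\<close> and \<open>k\<close>.\<close>
        have "32 * (\<gamma> + 1) \<le> c ^ Suc s"
        proof -
          have "32 * (\<gamma> + 1) = 4 * (8 * (\<gamma> + 1))" by simp
          also have "\<dots> \<le> 72 * \<kappa>" using \<kappa> \<gamma> by (intro mult_mono \<kappa>\<gamma>) auto
          also have "\<dots> \<le> \<kappa> * \<kappa>" using \<kappa> by (intro mult_right_mono) auto
          also have "\<dots> = c ^ 1" by (simp add: c_def power2_eq_square)
          also have "\<dots> \<le> c ^ Suc s"
          proof (intro power_increasing)
            have "1\<^sup>2 \<le> \<kappa>\<^sup>2" using \<kappa> by (intro power_mono) auto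
            then show "1 \<le> c" by (simp add: c_def)
          qed simp
          finally show ?thesis .
        qed
        then have "L\<^sup>2 / (c ^ Suc s * \<mu>) \<le> L\<^sup>2 / (32 * (\<gamma> + 1) * \<mu>)"
          using \<gamma> \<mu> c_pos by (intro divide_left_mono mult_right_mono mult_pos_pos) auto
        also have "\<dots> = L / (4 * (\<gamma> + 1)) * (L / (8 * \<mu>))" by (simp add: power2_eq_square)
        also have "\<dots> \<le> real g * real k" using g_ge k_ge L2 \<mu> \<gamma> by (intro mult_mono) auto
        finally show ?thesis .
      qed
      then have "2 powr indep_exponent c (Suc s) (card P) \<le> 2 powr real (g * k)"
        unfolding expo by (intro powr_mono) auto
      also have "\<dots> = real (2 ^ (g * k))" by (subst powr_realpow) auto
      also have "\<dots> \<le> real (card I)" using I(3) by (simp only: of_nat_le_iff)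
      finally show ?thesis using I(1,2) by blast
    qed
  qed
qed

text \<open>The induction on \<open>s\<close> keeps \<open>C\<close> fixed, so the same
  \<open>c\<close>, a function of \<open>C\<close> alone, serves for all \<open>s\<close>.\<close>

lemma ex_large_independent:
  fixes C :: nat
  shows "\<exists>c::real. c > 0 \<and> (\<forall>s (P :: 'a set) E. cutting P E C \<longrightarrow> clique_free3 s P E \<longrightarrow> 16 < card P \<longrightarrow>
    (\<exists>P'\<subseteq>P. nsets P' 3 \<inter> E = {} \<and> 2 powr indep_exponent c s (card P) \<le> real (card P')))"
proof -
  define c where "c = (real (8 * (5 * C + 9) + 8 * C * (5 * C + 2) ^ 3))\<^sup>2"
  have "\<exists>P'\<subseteq>P. nsets P' 3 \<inter> E = {} \<and> 2 powr indep_exponent c s (card P) \<le> real (card P')"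
    if "cutting P E C" "clique_free3 s P E" "16 < card P" for s and P :: "'a set" and E
    using that
  proof (induction s arbitrary: P)
    case 0
    \<comment> \<open>The empty set contains no triple, so no relation is clique-free for
      \<open>s = 0\<close> and the induction can start there.\<close>
    have "{} \<in> nsets P 0" by (simp add: nsets_def)
    then obtain T where "T \<in> nsets ({} :: 'a set) 3" using 0 by (auto simp: clique_free3_def)
    then show ?case by (simp add: nsets_3_iff)
  next
    case (Suc s)
    show ?case unfolding c_def
      by (rule ex_independent_step[OF Suc.prems]) (use Suc.IH in \<open>simp add: c_def\<close>)
  qed
  moreover have "(0::real) < real (8 * (5 * C + 9) + 8 * C * (5 * C + 2) ^ 3)"
    by (simp only: of_nat_0_less_iff) simp
  then have "0 < c" unfolding c_def by (rule zero_less_power)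
  ultimately show ?thesis by blast
qed

theorem theorem15:
  fixes t :: nat
  assumes "t \<ge> 1"
  shows "\<exists>c::real. c > 0 \<and>
    (\<forall>(s::nat) (P :: (real ^ 'd) set) (E :: (real ^ 'd) set set).
       s \<ge> 3 \<longrightarrow> finite P \<longrightarrow> card P > 16 \<longrightarrow>
       symmetric_semialgebraic3 t P E \<longrightarrow> clique_free3 s P E \<longrightarrow>
       (\<exists>P' \<subseteq> P. nsets P' 3 \<inter> E = {} \<and>
          real (card P') \<ge>
            2 powr ((log 2 (log 2 (real (card P))))\<^sup>2 /
                    (c ^ s * log 2 (log 2 (log 2 (real (card P))))))))"
proof -
  obtain C where C: "\<And>(P :: (real ^ 'd) set) E. finite P \<Longrightarrow> symmetric_semialgebraic3 t P E \<Longrightarrow> cutting P E C"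
    using cutting_if_semialgebraic by blast
  obtain c :: real where "c > 0" and c: "\<And>s (P :: (real ^ 'd) set) E. cutting P E C \<Longrightarrow> clique_free3 s P E \<Longrightarrow>
    16 < card P \<Longrightarrow> \<exists>P'\<subseteq>P. nsets P' 3 \<inter> E = {} \<and> 2 powr indep_exponent c s (card P) \<le> real (card P')"
    using ex_large_independent[of C] by blast
  show ?thesis
    by (intro exI[of _ c] conjI allI impI \<open>c > 0\<close> c[unfolded indep_exponent_def] C)
qed

end
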